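(* Let $f:\mathrm{Gr}(k,n)\to\mathbb{R}$ be (the restriction of) a $C^2$ function defined on an open neighbourhood of $\mathrm{Gr}(k,n)$ in $\mathbb{R}^{n\times n}$. For $Q=[q_{ij}]\in\mathrm{Gr}(k,n)$, let $f_Q:=\bigl[\frac{\partial f}{\partial q_{ij}}(Q)\bigr]_{i,j=1}^n\in\mathbb{R}^{n\times n}$ and, for $X=[x_{ij}],Y=[y_{ij}]\in\mathbb{R}^{n\times n}$, \[ f_{QQ}(X,Y):=\sum_{i,j,p,l=1}^n\Bigl(\frac{\partial^2f}{\partial q_{ij}\,\partial q_{pl}}(Q)\Bigr)x_{ij}y_{pl}. \] Then, as a bilinear map on $\mathbb{T}_Q\mathrm{Gr}(k,n)\times\mathbb{T}_Q\mathrm{Gr}(k,n)$, the Riemannian Hessian of $f$ at $Q$ is \[ \nabla^2f(Q)(X,Y)=f_{QQ}(X,Y)-\tfrac12\operatorname{tr}\bigl(f_Q^{\mathsf T}Q(XY+YX)\bigr) \] for all $X,Y\in\mathbb{T}_Q\mathrm{Gr}(k,n)$.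
   Context: For $k\in\{1,\dots,n\}$, $\mathrm{Gr}(k,n)=\{Q\in\mathrm{O}(n):Q^{\mathsf T}=Q,\ \operatorname{tr}(Q)=2k-n\}$, an embedded submanifold of $\mathbb{R}^{n\times n}$, equipped with the Riemannian metric $\langle X,Y\rangle_Q=\operatorname{tr}(XY)$ for $X,Y\in\mathbb{T}_Q\mathrm{Gr}(k,n)$ (tangent vectors are symmetric matrices). The Riemannian Hessian is that of the Levi-Civita connection; it is the symmetric bilinear form with $\nabla^2f(Q)(X,X)=\frac{d^2}{dt^2}f(\gamma(t))\big|_{t=0}$ for the geodesic $\gamma$ with $\gamma(0)=Q$, $\dot\gamma(0)=X$. Partial derivatives are with respect to the $n^2$ entries of a matrix in $\mathbb{R}^{n\times n}$. *)

theory Defs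
  imports "HOL-Analysis.Analysis"
begin

section \<open>Functions of class \<open>C\<^sup>k\<close> and smooth functions on subsets\<close>

text \<open>Intended for open \<open>U\<close>. In finite dimension, continuity of all directional derivatives
  \<open>x \<mapsto> Df(x) v\<close> amounts to continuity of the derivative, so this is the usual class.\<close>

fun Ck_on :: "nat \<Rightarrow> 'a::euclidean_space set \<Rightarrow> ('a \<Rightarrow> 'b::euclidean_space) \<Rightarrow> bool" where
  "Ck_on 0 U f \<longleftrightarrow> continuous_on U f"
| "Ck_on (Suc m) U f \<longleftrightarrow> (\<forall>x\<in>U. f differentiable (at x)) \<and>
     (\<forall>v. Ck_on m U (\<lambda>x. frechet_derivative f (at x) v))"

definition Cinf_on :: "'a::euclidean_space set \<Rightarrow> ('a \<Rightarrow> 'b::euclidean_space) \<Rightarrow> bool" where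
  "Cinf_on U f \<longleftrightarrow> (\<forall>m. Ck_on m U f)"

text \<open>Functions and vector fields on an embedded submanifold \<open>M\<close> are represented by functions
  on the ambient space of which only the values on \<open>M\<close> matter. Smoothness means having smooth
  local extensions.\<close>

definition smooth_on_sub :: "'a::euclidean_space set \<Rightarrow> ('a \<Rightarrow> 'b::euclidean_space) \<Rightarrow> bool" where
  "smooth_on_sub M f \<longleftrightarrow>
     (\<forall>p\<in>M. \<exists>V h. open V \<and> p \<in> V \<and> Cinf_on V h \<and> (\<forall>q\<in>M \<inter> V. h q = f q))"


section \<open>Tangent vectors and derivatives along them\<close>

definition curve_through ::
    "'a::euclidean_space set \<Rightarrow> 'a \<Rightarrow> 'a \<Rightarrow> (real \<Rightarrow> 'a) \<Rightarrow> bool" where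
  "curve_through M p v c \<longleftrightarrow>
     (\<exists>e>0. Cinf_on {-e<..<e} c \<and> c ` {-e<..<e} \<subseteq> M) \<and>
     c 0 = p \<and> (c has_vector_derivative v) (at 0)"

definition tangent_space :: "'a::euclidean_space set \<Rightarrow> 'a \<Rightarrow> 'a set" where
  "tangent_space M p = {v. \<exists>c. curve_through M p v c}"

text \<open>The derivative of \<open>f\<close> at \<open>p\<close> along the tangent vector \<open>v\<close>; it only depends on the
  restriction of \<open>f\<close> to \<open>M\<close>.\<close>

definition tderiv ::
    "'a::euclidean_space set \<Rightarrow> ('a \<Rightarrow> real) \<Rightarrow> 'a \<Rightarrow> 'a \<Rightarrow> real" where
  "tderiv M f p v =
     (THE d. \<forall>c. curve_through M p v c \<longrightarrow> ((\<lambda>t. f (c t)) has_real_derivative d) (at 0))"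

definition vector_field :: "'a::euclidean_space set \<Rightarrow> ('a \<Rightarrow> 'a) \<Rightarrow> bool" where
  "vector_field M X \<longleftrightarrow> smooth_on_sub M X \<and> (\<forall>p\<in>M. X p \<in> tangent_space M p)"

text \<open>The function \<open>X f\<close> obtained by letting the vector field \<open>X\<close> act on \<open>f\<close>.\<close>

definition field_deriv ::
    "'a::euclidean_space set \<Rightarrow> ('a \<Rightarrow> 'a) \<Rightarrow> ('a \<Rightarrow> real) \<Rightarrow> 'a \<Rightarrow> real" where
  "field_deriv M X f p = tderiv M f p (X p)"


section \<open>Levi-Civita connection and Riemannian Hessian\<close>

text \<open>The second clause expresses that \<open>D X Y\<close> depends only on the values of
  \<open>X\<close> and \<open>Y\<close> on \<open>M\<close>.\<close>

definition affine_connection ::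
    "'a::euclidean_space set \<Rightarrow> (('a \<Rightarrow> 'a) \<Rightarrow> ('a \<Rightarrow> 'a) \<Rightarrow> 'a \<Rightarrow> 'a) \<Rightarrow> bool" where
  "affine_connection M D \<longleftrightarrow>
     (\<forall>X Y. vector_field M X \<longrightarrow> vector_field M Y \<longrightarrow> vector_field M (D X Y)) \<and>
     (\<forall>X X' Y Y'. vector_field M X \<longrightarrow> vector_field M X' \<longrightarrow>
        vector_field M Y \<longrightarrow> vector_field M Y' \<longrightarrow>
        (\<forall>q\<in>M. X q = X' q) \<longrightarrow> (\<forall>q\<in>M. Y q = Y' q) \<longrightarrow> (\<forall>p\<in>M. D X Y p = D X' Y' p)) \<and>
     (\<forall>X X' Y. vector_field M X \<longrightarrow> vector_field M X' \<longrightarrow> vector_field M Y \<longrightarrow>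
        (\<forall>p\<in>M. D (\<lambda>q. X q + X' q) Y p = D X Y p + D X' Y p)) \<and>
     (\<forall>\<phi> X Y. smooth_on_sub M \<phi> \<longrightarrow> vector_field M X \<longrightarrow> vector_field M Y \<longrightarrow>
        (\<forall>p\<in>M. D (\<lambda>q. \<phi> q *\<^sub>R X q) Y p = \<phi> p *\<^sub>R D X Y p)) \<and>
     (\<forall>X Y Y'. vector_field M X \<longrightarrow> vector_field M Y \<longrightarrow> vector_field M Y' \<longrightarrow>
        (\<forall>p\<in>M. D X (\<lambda>q. Y q + Y' q) p = D X Y p + D X Y' p)) \<and>
     (\<forall>\<phi> X Y. smooth_on_sub M \<phi> \<longrightarrow> vector_field M X \<longrightarrow> vector_field M Y \<longrightarrow>
        (\<forall>p\<in>M. D X (\<lambda>q. \<phi> q *\<^sub>R Y q) p = field_deriv M X \<phi> p *\<^sub>R Y p + \<phi> p *\<^sub>R D X Y p))"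

definition metric_compatible ::
    "'a::euclidean_space set \<Rightarrow> ('a \<Rightarrow> 'a \<Rightarrow> 'a \<Rightarrow> real) \<Rightarrow>
     (('a \<Rightarrow> 'a) \<Rightarrow> ('a \<Rightarrow> 'a) \<Rightarrow> 'a \<Rightarrow> 'a) \<Rightarrow> bool" where
  "metric_compatible M g D \<longleftrightarrow>
     (\<forall>X Y Z. vector_field M X \<longrightarrow> vector_field M Y \<longrightarrow> vector_field M Z \<longrightarrow>
        (\<forall>p\<in>M. field_deriv M X (\<lambda>q. g q (Y q) (Z q)) p =
                 g p (D X Y p) (Z p) + g p (Y p) (D X Z p)))"

text \<open>\<open>D\<^sub>X Y - D\<^sub>Y X = [X, Y]\<close>, both sides seen as derivations on smooth functions.\<close>

definition torsion_free ::
    "'a::euclidean_space set \<Rightarrow> (('a \<Rightarrow> 'a) \<Rightarrow> ('a \<Rightarrow> 'a) \<Rightarrow> 'a \<Rightarrow> 'a) \<Rightarrow> bool" where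
  "torsion_free M D \<longleftrightarrow>
     (\<forall>X Y \<phi>. vector_field M X \<longrightarrow> vector_field M Y \<longrightarrow> smooth_on_sub M \<phi> \<longrightarrow>
        (\<forall>p\<in>M. field_deriv M (D X Y) \<phi> p - field_deriv M (D Y X) \<phi> p =
                 field_deriv M X (field_deriv M Y \<phi>) p - field_deriv M Y (field_deriv M X \<phi>) p))"

definition is_levi_civita ::
    "'a::euclidean_space set \<Rightarrow> ('a \<Rightarrow> 'a \<Rightarrow> 'a \<Rightarrow> real) \<Rightarrow>
     (('a \<Rightarrow> 'a) \<Rightarrow> ('a \<Rightarrow> 'a) \<Rightarrow> 'a \<Rightarrow> 'a) \<Rightarrow> bool" where
  "is_levi_civita M g D \<longleftrightarrow>
     affine_connection M D \<and> metric_compatible M g D \<and> torsion_free M D"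

text \<open>On a Riemannian submanifold the Levi-Civita connection is unique only up to the irrelevant
  values off \<open>M\<close> and on arguments that are not vector fields; hence \<open>SOME\<close> instead of \<open>THE\<close>.\<close>

definition levi_civita ::
    "'a::euclidean_space set \<Rightarrow> ('a \<Rightarrow> 'a \<Rightarrow> 'a \<Rightarrow> real) \<Rightarrow>
     ('a \<Rightarrow> 'a) \<Rightarrow> ('a \<Rightarrow> 'a) \<Rightarrow> 'a \<Rightarrow> 'a" where
  "levi_civita M g = (SOME D. is_levi_civita M g D)"

text \<open>\<open>\<nabla>\<^sup>2f(X, Y) = X(Y f) - (\<nabla>\<^sub>X Y) f\<close>, evaluated at \<open>p\<close> on any vector fields that extend the
  tangent vectors \<open>x\<close> and \<open>y\<close>.\<close>

definition riemannian_hessian ::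
    "'a::euclidean_space set \<Rightarrow> ('a \<Rightarrow> 'a \<Rightarrow> 'a \<Rightarrow> real) \<Rightarrow> ('a \<Rightarrow> real) \<Rightarrow>
     'a \<Rightarrow> 'a \<Rightarrow> 'a \<Rightarrow> real" where
  "riemannian_hessian M g f p x y =
     (THE h. \<forall>X Y. vector_field M X \<longrightarrow> vector_field M Y \<longrightarrow> X p = x \<longrightarrow> Y p = y \<longrightarrow>
        h = field_deriv M X (field_deriv M Y f) p - field_deriv M (levi_civita M g X Y) f p)"


section \<open>The Grassmannian in the involution model\<close>

definition Gr :: "nat \<Rightarrow> (real^'n^'n) set" where
  "Gr k = {Q. orthogonal_matrix Q \<and> transpose Q = Q \<and> trace Q = 2 * real k - real CARD('n)}"

definition Gr_metric :: "real^'n^'n \<Rightarrow> real^'n^'n \<Rightarrow> real^'n^'n \<Rightarrow> real" where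
  "Gr_metric Q X Y = trace (X ** Y)"


section \<open>Entrywise partial derivatives\<close>

definition entry_partial ::
    "'n \<Rightarrow> 'n \<Rightarrow> (real^'n^'n \<Rightarrow> real) \<Rightarrow> real^'n^'n \<Rightarrow> real" where
  "entry_partial i j f Q = deriv (\<lambda>t. f (Q + t *\<^sub>R axis i (axis j 1))) 0"

definition grad_matrix :: "(real^'n^'n \<Rightarrow> real) \<Rightarrow> real^'n^'n \<Rightarrow> real^'n^'n" where
  "grad_matrix f Q = (\<chi> i j. entry_partial i j f Q)"

definition second_form ::
    "(real^'n^'n \<Rightarrow> real) \<Rightarrow> real^'n^'n \<Rightarrow> real^'n^'n \<Rightarrow> real^'n^'n \<Rightarrow> real" where
  "second_form f Q X Y =
     (\<Sum>i\<in>UNIV. \<Sum>j\<in>UNIV. \<Sum>p\<in>UNIV. \<Sum>l\<in>UNIV.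
        entry_partial i j (entry_partial p l f) Q * X $ i $ j * Y $ p $ l)"

end

theory Submission
  imports Defs
begin

text \<open>The tangent space of \<open>Gr k\<close> at \<open>q\<close> consists of the symmetric \<open>X\<close> with \<open>X q + q X = 0\<close>; it is
  reached by the curves \<open>exp (t A) q exp (- t A)\<close> with \<open>A = X q / 2\<close> skew. The orthogonal projection of
  a symmetric \<open>W\<close> onto it is \<open>(W - q W q) / 2\<close>, and projecting the flat derivative \<open>DY(X)\<close> gives the
  Levi-Civita connection. With \<open>f\<close> extended to the ambient space,
  \<open>X (Y f) = D\<^sup>2f(X, Y) + Df(DY(X))\<close>, so only the normal part of \<open>DY(X)\<close> survives in
  \<open>X (Y f) - (\<nabla>\<^sub>X Y) f\<close>. Differentiating \<open>Y q + q Y = 0\<close> along \<open>X\<close> shows that this normal part is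
  \<open>- q (X Y + Y X) / 2\<close>.\<close>

section \<open>Calculus of functions of class \<open>C\<^sup>k\<close>\<close>

text \<open>The connection is picked by \<open>SOME\<close>, and directional derivatives and the
  Hessian by \<open>THE\<close>. A connection with the right formula therefore settles nothing until
  it satisfies every Levi-Civita axiom, any two such connections agree on vector fields, and each
  tangent vector extends to a vector field; \<open>gr_proj q x\<close> as a function of
  \<open>q\<close> is that extension. Vector fields come with smooth local extensions only, so
  derivatives are computed on an extension near each point and shown to depend on values on the
  submanifold alone. \<open>f\<close> itself is only twice continuously differentiable, hence a
  calculus graded by the order of differentiability. The constant 1/2 comes from the complementary
  projection: with \<open>W\<close> the flat derivative of \<open>Y\<close> along \<open>X\<close>
  at \<open>p\<close>, the equation \<open>W p + p W = - (X Y + Y X)\<close> multiplied by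
  \<open>p\<close> on the left becomes \<open>W + p W p = - p (X Y + Y X)\<close>, and the left side
  is twice the normal part of \<open>W\<close>.\<close>

lemma Ck_on_cong:
  assumes "open U" "Ck_on m U f" "\<And>x. x \<in> U \<Longrightarrow> f x = g x"
  shows "Ck_on m U g"
  using assms(2,3)
proof (induction m arbitrary: f g)
  case 0
  then show ?case using continuous_on_cong by force
next
  case (Suc m)
  have "frechet_derivative f (at x) = frechet_derivative g (at x)" if "x \<in> U" for x
    using frechet_derivative_transform_within_open[OF _ assms(1) that] Suc.prems that by auto
  moreover have "g differentiable (at x)" if "x \<in> U" for x
    using Suc.prems that assms(1) differentiable_def has_derivative_transform_within_open
    by (metis Ck_on.simps(2))
  moreover have "Ck_on m U (\<lambda>x. frechet_derivative g (at x) v)" for v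
    using Suc.IH[of "\<lambda>x. frechet_derivative f (at x) v"] Suc.prems(1) calculation(1) by simp
  ultimately show ?case
    by simp
qed

lemma Ck_on_subset: "Ck_on m U f \<Longrightarrow> V \<subseteq> U \<Longrightarrow> Ck_on m V f"
  by (induction m arbitrary: f) (auto intro: continuous_on_subset)

lemma Ck_on_SucD: "Ck_on (Suc m) U f \<Longrightarrow> Ck_on m U f"
proof (induction m arbitrary: f)
  case 0
  then show ?case
    by (auto intro!: continuous_at_imp_continuous_on differentiable_imp_continuous_within)
next
  case (Suc m)
  then show ?case by (metis Ck_on.simps(2))
qed

lemma Ck_on_Suc_has_derivative:
  "Ck_on (Suc m) U f \<Longrightarrow> x \<in> U \<Longrightarrow> (f has_derivative frechet_derivative f (at x)) (at x)"
  by (simp flip: frechet_derivative_works)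

lemma Ck_on_const: "Ck_on m U (\<lambda>x. c)"
  by (induction m arbitrary: c) auto

lemma Ck_on_ident: "Ck_on m U (\<lambda>x. x)"
  by (cases m) (auto simp: Ck_on_const)

lemma Ck_on_linear:
  assumes "bounded_linear L" "open U" "Ck_on m U f"
  shows "Ck_on m U (\<lambda>x. L (f x))"
  using assms(3)
proof (induction m arbitrary: f)
  case 0
  then show ?case using assms(1) by (simp add: bounded_linear.continuous_on)
next
  case (Suc m)
  have d: "((\<lambda>x. L (f x)) has_derivative (\<lambda>v. L (frechet_derivative f (at x) v))) (at x)"
    if "x \<in> U" for x
    using bounded_linear.has_derivative[OF assms(1)] Ck_on_Suc_has_derivative Suc.prems that by blast
  have "Ck_on m U (\<lambda>x. frechet_derivative (\<lambda>x. L (f x)) (at x) v)" for v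
    by (rule Ck_on_cong[OF assms(2) Suc.IH[of "\<lambda>x. frechet_derivative f (at x) v"]])
      (use Suc.prems frechet_derivative_at[OF d, symmetric] in simp_all)
  then show ?case using differentiableI[OF d] by simp
qed

lemma Ck_on_add:
  assumes "open U" "Ck_on m U f" "Ck_on m U g"
  shows "Ck_on m U (\<lambda>x. f x + g x)"
  using assms(2,3)
proof (induction m arbitrary: f g)
  case 0
  then show ?case by (simp add: continuous_on_add)
next
  case (Suc m)
  have d: "((\<lambda>x. f x + g x) has_derivative
      (\<lambda>v. frechet_derivative f (at x) v + frechet_derivative g (at x) v)) (at x)"
    if "x \<in> U" for x
    by (intro has_derivative_add Ck_on_Suc_has_derivative[OF Suc.prems(1)]
        Ck_on_Suc_has_derivative[OF Suc.prems(2)] that)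
  have "Ck_on m U (\<lambda>x. frechet_derivative (\<lambda>x. f x + g x) (at x) v)" for v
    by (rule Ck_on_cong[OF assms(1) Suc.IH[of "\<lambda>x. frechet_derivative f (at x) v"
            "\<lambda>x. frechet_derivative g (at x) v"]])
      (use Suc.prems frechet_derivative_at[OF d, symmetric] in simp_all)
  then show ?case using differentiableI[OF d] by simp
qed

lemma Ck_on_bilinear:
  assumes "bounded_bilinear B" "open U" "Ck_on m U f" "Ck_on m U g"
  shows "Ck_on m U (\<lambda>x. B (f x) (g x))"
  using assms(3,4)
proof (induction m arbitrary: f g)
  case 0
  then show ?case using assms(1) by (simp add: bounded_bilinear.continuous_on)
next
  case (Suc m)
  have d: "((\<lambda>x. B (f x) (g x)) has_derivative
      (\<lambda>v. B (f x) (frechet_derivative g (at x) v) + B (frechet_derivative f (at x) v) (g x))) (at x)"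
    if "x \<in> U" for x
    by (intro bounded_bilinear.FDERIV[OF assms(1)] Ck_on_Suc_has_derivative[OF Suc.prems(1)]
        Ck_on_Suc_has_derivative[OF Suc.prems(2)] that)
  have "Ck_on m U (\<lambda>x. B (f x) (frechet_derivative g (at x) v) + B (frechet_derivative f (at x) v) (g x))"
    for v
    \<comment> \<open>The product rule keeps one factor undifferentiated in each term, so
      \<open>f\<close> and \<open>g\<close> themselves are also needed at the lower class
      \<open>m\<close>.\<close>
    using Suc.prems Ck_on_SucD[OF Suc.prems(1)] Ck_on_SucD[OF Suc.prems(2)]
    by (intro Ck_on_add Suc.IH assms) simp_all
  then have "Ck_on m U (\<lambda>x. frechet_derivative (\<lambda>x. B (f x) (g x)) (at x) v)" for v
    by (rule Ck_on_cong[OF assms(2)]) (simp add: frechet_derivative_at[OF d, symmetric])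
  then show ?case using differentiableI[OF d] by simp
qed

lemma Ck_on_sum:
  assumes "open U" "\<And>i. i \<in> I \<Longrightarrow> Ck_on m U (f i)"
  shows "Ck_on m U (\<lambda>x. \<Sum>i\<in>I. f i x)"
proof (cases "finite I")
  case True
  then show ?thesis using assms(2)
    by (induction I rule: finite_induct) (auto intro: Ck_on_const Ck_on_add[OF assms(1)])
qed (simp add: Ck_on_const)

lemma frechet_derivative_basis_expansion:
  fixes f :: "'a::euclidean_space \<Rightarrow> 'b::euclidean_space"
  assumes "f differentiable (at x)"
  shows "frechet_derivative f (at x) v = (\<Sum>b\<in>Basis. (v \<bullet> b) *\<^sub>R frechet_derivative f (at x) b)"
proof -
  have "frechet_derivative f (at x) v = frechet_derivative f (at x) (\<Sum>b\<in>Basis. (v \<bullet> b) *\<^sub>R b)"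
    by (simp add: euclidean_representation)
  then show ?thesis
    using linear_frechet_derivative[OF assms] by (simp add: linear_sum linear_scale o_def)
qed

text \<open>\<open>Ck_on\<close> controls derivatives in one fixed direction at a time. Expanding
  the varying direction \<open>h q\<close> in the basis leaves finitely many fixed directions, with
  coefficients as regular as \<open>h\<close>.\<close>

lemma Ck_on_frechet_derivative_field:
  assumes "open U" "Ck_on (Suc m) U f" "Ck_on m U h"
  shows "Ck_on m U (\<lambda>q. frechet_derivative f (at q) (h q))"
proof (rule Ck_on_cong[OF assms(1)])
  show "Ck_on m U (\<lambda>q. \<Sum>b\<in>Basis. (h q \<bullet> b) *\<^sub>R frechet_derivative f (at q) b)"
    using assms by (auto intro!: Ck_on_sum Ck_on_bilinear[OF bounded_bilinear_scaleR]
        Ck_on_linear[OF bounded_linear_inner_left])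
next
  fix q assume "q \<in> U"
  then have "f differentiable (at q)"
    using assms(2) by simp
  then show "(\<Sum>b\<in>Basis. (h q \<bullet> b) *\<^sub>R frechet_derivative f (at q) b) = frechet_derivative f (at q) (h q)"
    by (simp flip: frechet_derivative_basis_expansion)
qed

text \<open>A product rule: one term moves the base point with the direction frozen at
  \<open>h p\<close>, the other moves the direction. It is the source of the formula for
  \<open>X (Y f)\<close>.\<close>

lemma has_derivative_frechet_derivative_field:
  fixes f :: "'a::euclidean_space \<Rightarrow> 'b::euclidean_space"
  assumes "open U" "p \<in> U" "Ck_on 2 U f" "(h has_derivative h') (at p)"
  shows "((\<lambda>q. frechet_derivative f (at q) (h q)) has_derivative
    (\<lambda>x. frechet_derivative (\<lambda>q. frechet_derivative f (at q) (h p)) (at p) x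
       + frechet_derivative f (at p) (h' x))) (at p)"
proof -
  let ?G = "\<lambda>v q. frechet_derivative f (at q) v"
  let ?D = "\<lambda>v x. frechet_derivative (?G v) (at p) x"
  have f: "f differentiable (at q)" if "q \<in> U" for q
    using assms(3) that by (auto simp: numeral_2_eq_2)
  have G: "(?G v has_derivative ?D v) (at p)" for v
    using assms(2,3) by (auto simp: numeral_2_eq_2 simp flip: frechet_derivative_works)
  have sumG: "((\<lambda>q. \<Sum>b\<in>Basis. (h q \<bullet> b) *\<^sub>R ?G b q) has_derivative
     (\<lambda>x. \<Sum>b\<in>Basis. (h p \<bullet> b) *\<^sub>R ?D b x + (h' x \<bullet> b) *\<^sub>R ?G b p)) (at p)"
    by (intro has_derivative_sum has_derivative_scaleR G has_derivative_inner_left assms(4))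
  have "((\<lambda>q. \<Sum>b\<in>Basis. (h p \<bullet> b) *\<^sub>R ?G b q) has_derivative
     (\<lambda>x. \<Sum>b\<in>Basis. (h p \<bullet> b) *\<^sub>R ?D b x)) (at p)"
    by (intro has_derivative_sum has_derivative_scaleR_right G)
  then have "(?G (h p) has_derivative (\<lambda>x. \<Sum>b\<in>Basis. (h p \<bullet> b) *\<^sub>R ?D b x)) (at p)"
    by (rule has_derivative_transform_within_open[OF _ assms(1,2)])
      (simp add: f flip: frechet_derivative_basis_expansion)
  from fun_cong[OF frechet_derivative_at[OF this], symmetric]
  have D: "?D (h p) x = (\<Sum>b\<in>Basis. (h p \<bullet> b) *\<^sub>R ?D b x)" for x .
  have "((\<lambda>q. ?G (h q) q) has_derivative
     (\<lambda>x. \<Sum>b\<in>Basis. (h p \<bullet> b) *\<^sub>R ?D b x + (h' x \<bullet> b) *\<^sub>R ?G b p)) (at p)"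
    by (rule has_derivative_transform_within_open[OF sumG assms(1,2)])
      (simp add: f flip: frechet_derivative_basis_expansion)
  then show ?thesis
    unfolding D sum.distrib frechet_derivative_basis_expansion[OF f[OF assms(2)], symmetric] .
qed

section \<open>Symmetry of second derivatives\<close>

lemma directional_derivative_on_line:
  fixes g :: "'a::euclidean_space \<Rightarrow> real"
  assumes "g differentiable (at (p + s *\<^sub>R u))"
  shows "((\<lambda>s. g (p + s *\<^sub>R u)) has_real_derivative frechet_derivative g (at (p + s *\<^sub>R u)) u) (at s)"
proof -
  let ?D = "frechet_derivative g (at (p + s *\<^sub>R u))"
  have "(g has_derivative ?D) (at (p + s *\<^sub>R u))"
    using assms frechet_derivative_works by blast
  moreover have "((\<lambda>s. p + s *\<^sub>R u) has_derivative (\<lambda>t. t *\<^sub>R u)) (at s)"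
    by (auto intro!: derivative_eq_intros)
  ultimately have "((\<lambda>s. g (p + s *\<^sub>R u)) has_derivative (\<lambda>t. ?D (t *\<^sub>R u))) (at s)"
    using diff_chain_at[of "\<lambda>s. p + s *\<^sub>R u" _ s g ?D] by (simp add: o_def)
  moreover have "?D (t *\<^sub>R u) = ?D u * t" for t
    using linear_scale[OF linear_frechet_derivative[OF assms]] by simp
  ultimately show ?thesis
    by (simp add: has_field_derivative_def)
qed

text \<open>Two applications of the mean value theorem: along \<open>u\<close> to the difference of
  \<open>g\<close> across the step \<open>s *\<^sub>R v\<close>, then along \<open>v\<close> to the
  resulting derivative.\<close>

lemma second_difference_mean_value:
  fixes g :: "'a::euclidean_space \<Rightarrow> real"
  assumes C2: "Ck_on 2 U g" and "s > 0"
    and box: "\<And>a b. \<lbrakk>0 \<le> a; a \<le> s; 0 \<le> b; b \<le> s\<rbrakk> \<Longrightarrow> p + a *\<^sub>R u + b *\<^sub>R v \<in> U"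
  obtains a b where "0 \<le> a" "a \<le> s" "0 \<le> b" "b \<le> s"
    "g (p + s *\<^sub>R u + s *\<^sub>R v) - g (p + s *\<^sub>R u) - g (p + s *\<^sub>R v) + g p
      = s * s * frechet_derivative (\<lambda>q. frechet_derivative g (at q) u) (at (p + a *\<^sub>R u + b *\<^sub>R v)) v"
proof -
  let ?Gu = "\<lambda>q. frechet_derivative g (at q) u"
  let ?H = "\<lambda>a. g ((p + s *\<^sub>R v) + a *\<^sub>R u) - g (p + a *\<^sub>R u)"
  have diff: "g differentiable (at q)" "?Gu differentiable (at q)" if "q \<in> U" for q
    using C2 that by (auto simp: numeral_2_eq_2)
  have "(?H has_real_derivative ?Gu ((p + s *\<^sub>R v) + a *\<^sub>R u) - ?Gu (p + a *\<^sub>R u)) (at a)"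
    if "0 \<le> a" "a \<le> s" for a
    by (intro DERIV_diff directional_derivative_on_line diff)
      (use box[of a s] box[of a 0] that in \<open>auto simp: algebra_simps\<close>)
  from MVT2[OF \<open>s > 0\<close>, of ?H, OF this] obtain a where a: "0 < a" "a < s"
    "?H s - ?H 0 = s * (?Gu ((p + s *\<^sub>R v) + a *\<^sub>R u) - ?Gu (p + a *\<^sub>R u))" by auto
  let ?K = "\<lambda>b. ?Gu ((p + a *\<^sub>R u) + b *\<^sub>R v)"
  have "(?K has_real_derivative frechet_derivative ?Gu (at ((p + a *\<^sub>R u) + b *\<^sub>R v)) v) (at b)"
    if "0 \<le> b" "b \<le> s" for b
    by (intro directional_derivative_on_line diff) (use box[of a b] that a in \<open>auto simp: algebra_simps\<close>)
  from MVT2[OF \<open>s > 0\<close>, of ?K, OF this] obtain b where b: "0 < b" "b < s"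
    "?K s - ?K 0 = s * frechet_derivative ?Gu (at ((p + a *\<^sub>R u) + b *\<^sub>R v)) v" by auto
  show ?thesis
    by (rule that[of a b]) (use a b in \<open>auto simp: algebra_simps\<close>)
qed

text \<open>The second difference over a parallelogram is unchanged when \<open>u\<close> and
  \<open>v\<close> are swapped, so the two mixed derivatives coincide at suitable points arbitrarily
  near \<open>p\<close>; their continuity carries this to \<open>p\<close>.\<close>

lemma second_derivative_symmetric:
  fixes g :: "'a::euclidean_space \<Rightarrow> real"
  assumes "open U" "p \<in> U" "Ck_on 2 U g"
  shows "frechet_derivative (\<lambda>q. frechet_derivative g (at q) u) (at p) v
       = frechet_derivative (\<lambda>q. frechet_derivative g (at q) v) (at p) u"
proof -
  let ?D = "\<lambda>u v q. frechet_derivative (\<lambda>q. frechet_derivative g (at q) u) (at q) v"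
  have near: "\<exists>q q'. \<bar>?D u v q - ?D u v p\<bar> < e \<and> \<bar>?D v u q' - ?D v u p\<bar> < e \<and> ?D u v q = ?D v u q'"
    if e: "e > 0" for e
  proof -
    have cont: "isCont (?D a b) p" for a b
      using assms by (auto simp: numeral_2_eq_2 continuous_on_eq_continuous_at)
    obtain d1 where d1: "d1 > 0" "\<And>q. dist q p < d1 \<Longrightarrow> \<bar>?D u v q - ?D u v p\<bar> < e"
      using cont[of u v, unfolded continuous_at_eps_delta, rule_format, OF e] by (auto simp: dist_real_def)
    obtain d2 where d2: "d2 > 0" "\<And>q. dist q p < d2 \<Longrightarrow> \<bar>?D v u q - ?D v u p\<bar> < e"
      using cont[of v u, unfolded continuous_at_eps_delta, rule_format, OF e] by (auto simp: dist_real_def)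
    obtain d3 where d3: "d3 > 0" "\<And>q. dist q p < d3 \<Longrightarrow> q \<in> U"
      using assms(1,2) by (auto simp: open_dist)
    define d where "d = min d1 (min d2 d3)"
    \<comment> \<open>The step keeps the whole parallelogram within distance \<open>d / 2\<close> of
      \<open>p\<close>; the \<open>+ 1\<close> keeps the denominator positive when both vectors
      vanish.\<close>
    define s where "s = d / (norm u + norm v + 1) / 2"
    have "d > 0" using d1 d2 d3 by (simp add: d_def)
    have nz: "norm u + norm v + 1 > 0"
      by (simp add: add_nonneg_pos)
    then have "s > 0" using \<open>d > 0\<close> by (simp add: s_def)
    have close: "dist (p + a *\<^sub>R u + b *\<^sub>R v) p < d" if "0 \<le> a" "a \<le> s" "0 \<le> b" "b \<le> s" for a b
    proof -
      have "dist (p + a *\<^sub>R u + b *\<^sub>R v) p = norm (a *\<^sub>R u + b *\<^sub>R v)"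
        by (simp add: dist_norm algebra_simps)
      also have "\<dots> \<le> a * norm u + b * norm v"
        using norm_triangle_ineq[of "a *\<^sub>R u" "b *\<^sub>R v"] that by simp
      also have "\<dots> \<le> s * norm u + s * norm v"
        using that by (intro add_mono mult_right_mono) auto
      also have "\<dots> \<le> s * (norm u + norm v + 1)"
        using \<open>s > 0\<close> by (simp add: algebra_simps)
      also have "\<dots> = d / 2" using nz by (simp add: s_def field_simps)
      also have "\<dots> < d" using \<open>d > 0\<close> by simp
      finally show ?thesis .
    qed
    have inU: "p + a *\<^sub>R u + b *\<^sub>R v \<in> U" if "0 \<le> a" "a \<le> s" "0 \<le> b" "b \<le> s" for a b
      using close[OF that] d3(2) by (simp add: d_def)
    have inU': "p + a *\<^sub>R v + b *\<^sub>R u \<in> U" if "0 \<le> a" "a \<le> s" "0 \<le> b" "b \<le> s" for a b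
      using inU[OF that(3,4,1,2)] by (simp add: add_ac)
    obtain a b where ab: "0 \<le> a" "a \<le> s" "0 \<le> b" "b \<le> s"
      "g (p + s *\<^sub>R u + s *\<^sub>R v) - g (p + s *\<^sub>R u) - g (p + s *\<^sub>R v) + g p
        = s * s * ?D u v (p + a *\<^sub>R u + b *\<^sub>R v)"
      using second_difference_mean_value[OF assms(3) \<open>s > 0\<close>, of p u v] inU by auto
    obtain a' b' where ab': "0 \<le> a'" "a' \<le> s" "0 \<le> b'" "b' \<le> s"
      "g (p + s *\<^sub>R v + s *\<^sub>R u) - g (p + s *\<^sub>R v) - g (p + s *\<^sub>R u) + g p
        = s * s * ?D v u (p + a' *\<^sub>R v + b' *\<^sub>R u)"
      using second_difference_mean_value[OF assms(3) \<open>s > 0\<close>, of p v u] inU' by auto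
    have "s * s * ?D u v (p + a *\<^sub>R u + b *\<^sub>R v) = s * s * ?D v u (p + b' *\<^sub>R u + a' *\<^sub>R v)"
      using ab(5) ab'(5) by (simp add: algebra_simps)
    then have "?D u v (p + a *\<^sub>R u + b *\<^sub>R v) = ?D v u (p + b' *\<^sub>R u + a' *\<^sub>R v)"
      using \<open>s > 0\<close> by simp
    then show ?thesis
      using close[OF ab(1-4)] close[OF ab'(3,4,1,2)] d1(2) d2(2) unfolding d_def min_less_iff_conj
      by blast
  qed
  have "\<bar>?D u v p - ?D v u p\<bar> < e" if "e > 0" for e
    using near[of "e / 2"] that by (smt (verit, best) field_sum_of_halves)
  then show ?thesis
    by (metis eq_iff_diff_eq_0 less_irrefl zero_less_abs_iff)
qed

section \<open>Smooth functions and derivatives along tangent vectors\<close>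

lemma Cinf_onD: "Cinf_on U f \<Longrightarrow> Ck_on m U f"
  by (simp add: Cinf_on_def)

lemma Cinf_on_differentiable: "Cinf_on U f \<Longrightarrow> x \<in> U \<Longrightarrow> f differentiable (at x)"
  using Cinf_onD[of U f 1] by simp

lemma Cinf_on_has_derivative:
  "Cinf_on U f \<Longrightarrow> x \<in> U \<Longrightarrow> (f has_derivative frechet_derivative f (at x)) (at x)"
  using Cinf_on_differentiable frechet_derivative_works by blast

lemma Cinf_on_subset: "Cinf_on U f \<Longrightarrow> V \<subseteq> U \<Longrightarrow> Cinf_on V f"
  by (meson Cinf_on_def Ck_on_subset)

lemma Cinf_on_const: "Cinf_on U (\<lambda>x. c)"
  by (simp add: Cinf_on_def Ck_on_const)

lemma Cinf_on_ident: "Cinf_on U (\<lambda>x. x)"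
  by (simp add: Cinf_on_def Ck_on_ident)

lemma Cinf_on_linear:
  "bounded_linear L \<Longrightarrow> open U \<Longrightarrow> Cinf_on U f \<Longrightarrow> Cinf_on U (\<lambda>x. L (f x))"
  by (simp add: Cinf_on_def Ck_on_linear)

lemma Cinf_on_add:
  "open U \<Longrightarrow> Cinf_on U f \<Longrightarrow> Cinf_on U g \<Longrightarrow> Cinf_on U (\<lambda>x. f x + g x)"
  by (simp add: Cinf_on_def Ck_on_add)

lemma Cinf_on_bilinear:
  "bounded_bilinear B \<Longrightarrow> open U \<Longrightarrow> Cinf_on U f \<Longrightarrow> Cinf_on U g \<Longrightarrow> Cinf_on U (\<lambda>x. B (f x) (g x))"
  by (simp add: Cinf_on_def Ck_on_bilinear)

lemma Cinf_on_diff: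
  assumes "open U" "Cinf_on U f" "Cinf_on U g"
  shows "Cinf_on U (\<lambda>x. f x - g x)"
  using Cinf_on_add[OF assms(1,2) Cinf_on_linear[OF bounded_linear_minus[OF bounded_linear_ident] assms(1,3)]]
  by simp

lemma Cinf_on_frechet_derivative_field:
  "open U \<Longrightarrow> Cinf_on U f \<Longrightarrow> Cinf_on U h \<Longrightarrow>
     Cinf_on U (\<lambda>q. frechet_derivative f (at q) (h q))"
  by (simp add: Cinf_on_def Ck_on_frechet_derivative_field del: Ck_on.simps)

text \<open>Bootstrapping: the derivative of \<open>E\<close> is a linear image of \<open>E\<close>,
  so each order of differentiability yields the next.\<close>

lemma Cinf_on_linear_ode:
  fixes E :: "real \<Rightarrow> 'a::euclidean_space"
  assumes "bounded_linear L" "\<And>t. (E has_vector_derivative L (E t)) (at t)"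
  shows "Cinf_on UNIV E"
proof -
  have d: "frechet_derivative E (at t) = (\<lambda>v. v *\<^sub>R L (E t))" for t
    using assms(2) frechet_derivative_at unfolding has_vector_derivative_def by metis
  have "Ck_on m UNIV E" for m
  proof (induction m)
    case 0
    then show ?case
      using assms(2) by (auto intro!: continuous_at_imp_continuous_on has_vector_derivative_continuous)
  next
    case (Suc m)
    then show ?case
      unfolding Ck_on.simps d using assms(2)
      by (auto intro!: Ck_on_linear[OF bounded_linear_scaleR_right] Ck_on_linear[OF assms(1)]
          intro: differentiableI_vector)
  qed
  then show ?thesis by (simp add: Cinf_on_def)
qed

text \<open>Near 0 an admissible curve stays in both \<open>M\<close> and \<open>V\<close>, so the
  chain rule for \<open>h\<close> gives the same number along every curve. Tangency of
  \<open>v\<close> supplies at least one curve, without which the description in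
  \<open>tderiv\<close> would not be unique.\<close>

lemma tderiv_eq:
  assumes "open V" "p \<in> V" "\<And>q. q \<in> M \<Longrightarrow> q \<in> V \<Longrightarrow> f q = h q"
    and h: "(h has_derivative h') (at p)" and v: "v \<in> tangent_space M p"
  shows "tderiv M f p v = h' v"
proof -
  have "((\<lambda>t. f (c t)) has_real_derivative h' v) (at 0)" if c: "curve_through M p v c" for c
  proof -
    obtain e where e: "e > 0" "Cinf_on {-e<..<e} c" "c ` {-e<..<e} \<subseteq> M"
      and c0: "c 0 = p" "(c has_vector_derivative v) (at 0)"
      using c unfolding curve_through_def by blast
    have "((\<lambda>t. h (c t)) has_derivative (\<lambda>t. h' (t *\<^sub>R v))) (at 0)"
      using diff_chain_at[of c "\<lambda>t. t *\<^sub>R v" 0 h h'] c0 h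
      by (simp add: o_def has_vector_derivative_def)
    moreover have "h' (t *\<^sub>R v) = h' v * t" for t
      using h by (simp add: has_derivative_def linear_scale bounded_linear.linear)
    ultimately have "((\<lambda>t. h (c t)) has_real_derivative h' v) (at 0)"
      by (simp add: has_field_derivative_def)
    moreover have "\<forall>\<^sub>F t in nhds 0. h (c t) = f (c t)"
    proof -
      have "isCont c 0"
        using c0(2) has_vector_derivative_continuous by blast
      then have "\<forall>\<^sub>F t in nhds 0. c t \<in> V"
        using assms(1,2) c0(1) unfolding continuous_at tendsto_at_iff_tendsto_nhds
        by (auto dest: topological_tendstoD)
      moreover have "\<forall>\<^sub>F t in nhds 0. t \<in> {-e<..<e}"
        by (rule eventually_nhds_in_open) (use e in auto)
      ultimately show ?thesis
        by eventually_elim (use assms(3) e(3) in \<open>auto simp: image_subset_iff\<close>)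
    qed
    ultimately show ?thesis
      using DERIV_cong_ev[of 0 0 "\<lambda>t. h (c t)" "\<lambda>t. f (c t)" "h' v" "h' v"] by simp
  qed
  moreover obtain c where "curve_through M p v c"
    using v unfolding tangent_space_def by blast
  ultimately show ?thesis
    unfolding tderiv_def by (intro the_equality) (auto dest: DERIV_unique)
qed

section \<open>Matrix-valued calculus\<close>

lemma bounded_bilinear_matrix_matrix_mult:
  "bounded_bilinear ((**) :: real^'n^'m \<Rightarrow> real^'p^'n \<Rightarrow> real^'p^'m)"
  unfolding bilinear_conv_bounded_bilinear[symmetric] bilinear_def
  by (auto intro!: linearI simp: matrix_matrix_mult_def vec_eq_iff ring_distribs sum.distrib
      sum_distrib_left mult_ac)

lemma bounded_linear_transpose: "bounded_linear (transpose :: real^'n^'m \<Rightarrow> real^'m^'n)"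
  unfolding linear_conv_bounded_linear[symmetric]
  by (auto intro!: linearI simp: transpose_def vec_eq_iff)

lemma bounded_linear_trace: "bounded_linear (trace :: real^'n^'n \<Rightarrow> real)"
  unfolding linear_conv_bounded_linear[symmetric]
  by (auto intro!: linearI simp: trace_def sum.distrib sum_distrib_left)

lemmas matrix_mult_simps =
  bounded_bilinear.add_left[OF bounded_bilinear_matrix_matrix_mult]
  bounded_bilinear.add_right[OF bounded_bilinear_matrix_matrix_mult]
  bounded_bilinear.diff_left[OF bounded_bilinear_matrix_matrix_mult]
  bounded_bilinear.diff_right[OF bounded_bilinear_matrix_matrix_mult]
  bounded_bilinear.minus_left[OF bounded_bilinear_matrix_matrix_mult]
  bounded_bilinear.minus_right[OF bounded_bilinear_matrix_matrix_mult]
  bounded_bilinear.scaleR_left[OF bounded_bilinear_matrix_matrix_mult]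
  bounded_bilinear.scaleR_right[OF bounded_bilinear_matrix_matrix_mult]

lemmas transpose_simps =
  linear_add[OF bounded_linear.linear[OF bounded_linear_transpose]]
  linear_diff[OF bounded_linear.linear[OF bounded_linear_transpose]]
  linear_neg[OF bounded_linear.linear[OF bounded_linear_transpose]]
  linear_scale[OF bounded_linear.linear[OF bounded_linear_transpose]]
  matrix_transpose_mul

lemmas trace_simps =
  linear_add[OF bounded_linear.linear[OF bounded_linear_trace]]
  linear_diff[OF bounded_linear.linear[OF bounded_linear_trace]]
  linear_neg[OF bounded_linear.linear[OF bounded_linear_trace]]
  linear_scale[OF bounded_linear.linear[OF bounded_linear_trace]]

lemma matrix_unit_expansion:
  fixes A :: "real^'n^'m"
  shows "A = (\<Sum>i\<in>UNIV. \<Sum>j\<in>UNIV. A $ i $ j *\<^sub>R axis i (axis j 1))"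
proof -
  have "(\<Sum>j\<in>UNIV. A $ i $ j * axis i (axis j 1) $ a $ b) = (if i = a then A $ i $ b else 0)" for i a b
    by (simp add: axis_def if_distrib[of "\<lambda>x. _ * x"] cong: if_cong)
  then show ?thesis
    by (simp add: vec_eq_iff)
qed

lemma row_abs_sum_le:
  fixes A :: "real^'n^'m"
  shows "(\<Sum>k\<in>UNIV. \<bar>A $ i $ k\<bar>) \<le> (\<Sum>i\<in>UNIV. \<Sum>k\<in>UNIV. \<bar>A $ i $ k\<bar>)"
  by (rule member_le_sum) (auto intro: sum_nonneg)

text \<open>\<open>E t\<close> is the exponential of \<open>t A\<close>, built entry by entry as a
  scalar power series with the entries of \<open>A\<close> to the \<open>n\<close> divided by
  \<open>fact n\<close> as coefficients.\<close>

lemma matrix_linear_ode_solution: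
  fixes A :: "real^'n^'n"
  obtains E where "E 0 = mat 1" "\<And>t. (E has_vector_derivative A ** E t) (at t)"
proof -
  define P where "P n = (((**) A) ^^ n) (mat 1)" for n
  \<comment> \<open>\<open>K\<close> dominates every absolute row sum of \<open>A\<close>, so
    entries of the \<open>n\<close>-th power are at most \<open>K ^ n\<close> and the exponential
    series of \<open>K * \<bar>t\<bar>\<close> is a majorant.\<close>
  define K where "K = (\<Sum>i\<in>UNIV. \<Sum>j\<in>UNIV. \<bar>A $ i $ j\<bar>)"
  define c where "c i j n = P n $ i $ j / fact n" for i j n
  define e where "e i j t = (\<Sum>n. c i j n * t ^ n)" for i j and t :: real
  have P_Suc: "P (Suc n) $ i $ j = (\<Sum>k\<in>UNIV. A $ i $ k * P n $ k $ j)" for n i j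
    by (simp add: P_def matrix_matrix_mult_def)
  have "K \<ge> 0" unfolding K_def by (intro sum_nonneg) auto
  have P_le: "\<bar>P n $ i $ j\<bar> \<le> K ^ n" for n i j
  proof (induction n arbitrary: i)
    case 0
    then show ?case by (simp add: P_def mat_def)
  next
    case (Suc n)
    have "\<bar>P (Suc n) $ i $ j\<bar> \<le> (\<Sum>k\<in>UNIV. \<bar>A $ i $ k\<bar> * K ^ n)"
      unfolding P_Suc
      by (intro order_trans[OF sum_abs] sum_mono) (auto simp: abs_mult intro: mult_left_mono Suc.IH)
    also have "\<dots> = (\<Sum>k\<in>UNIV. \<bar>A $ i $ k\<bar>) * K ^ n"
      by (simp add: sum_distrib_right)
    also have "\<dots> \<le> K * K ^ n"
      unfolding K_def using \<open>K \<ge> 0\<close> K_def by (intro mult_right_mono row_abs_sum_le) auto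
    finally show ?case by simp
  qed
  have summable: "summable (\<lambda>n. c i j n * t ^ n)" for i j t
  proof (rule summable_comparison_test')
    show "summable (\<lambda>n. inverse (fact n) * (K * \<bar>t\<bar>) ^ n)" by (rule summable_exp)
    show "norm (c i j n * t ^ n) \<le> inverse (fact n) * (K * \<bar>t\<bar>) ^ n" for n
      using mult_right_mono[OF P_le[of n i j], of "\<bar>t\<bar> ^ n / fact n"]
      by (simp add: c_def abs_mult power_abs power_mult_distrib field_simps)
  qed
  \<comment> \<open>The factor \<open>n + 1\<close> from termwise differentiation cancels against
    the factorial, which turns the recursion for the powers into the differential equation.\<close>
  have diffs: "diffs (c i j) n = (\<Sum>k\<in>UNIV. A $ i $ k * c k j n)" for i j n
  proof -
    have "diffs (c i j) n = P (Suc n) $ i $ j / fact n"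
      by (simp add: diffs_def c_def field_simps del: of_nat_Suc)
    then show ?thesis
      by (simp add: P_Suc c_def sum_divide_distrib)
  qed
  have deriv_e: "(e i j has_real_derivative (\<Sum>k\<in>UNIV. A $ i $ k * e k j t)) (at t)" for i j t
  proof -
    have "(\<Sum>n. diffs (c i j) n * t ^ n) = (\<Sum>n. \<Sum>k\<in>UNIV. A $ i $ k * (c k j n * t ^ n))"
      by (simp add: diffs sum_distrib_right mult.assoc)
    also have "\<dots> = (\<Sum>k\<in>UNIV. A $ i $ k * e k j t)"
      by (simp add: suminf_sum summable summable_mult suminf_mult e_def)
    finally show ?thesis
      using termdiffs_strong_converges_everywhere[OF summable, of i j t] unfolding e_def by simp
  qed
  show ?thesis
  proof
    let ?E = "\<lambda>t. \<chi> i j. e i j t"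
    have "c i j 0 = (mat 1 :: real^'n^'n) $ i $ j" for i j
      by (simp add: c_def P_def)
    then show "?E 0 = mat 1"
      by (simp add: e_def vec_eq_iff powser_zero)
    fix t
    \<comment> \<open>As a combination of constant matrix units, \<open>?E\<close> can be
      differentiated through its scalar entries.\<close>
    have E_eq: "(\<lambda>t. \<Sum>i\<in>UNIV. \<Sum>j\<in>UNIV. ?E t $ i $ j *\<^sub>R axis i (axis j 1)) = ?E"
      by (rule ext, rule matrix_unit_expansion[symmetric])
    have D_eq: "(\<Sum>i\<in>UNIV. \<Sum>j\<in>UNIV. (A ** ?E t) $ i $ j *\<^sub>R axis i (axis j 1)) = A ** ?E t"
      by (rule matrix_unit_expansion[symmetric])
    have "((\<lambda>t. \<Sum>i\<in>UNIV. \<Sum>j\<in>UNIV. ?E t $ i $ j *\<^sub>R axis i (axis j (1::real))) has_vector_derivative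
      (\<Sum>i\<in>UNIV. \<Sum>j\<in>UNIV. (A ** ?E t) $ i $ j *\<^sub>R axis i (axis j (1::real)))) (at t)"
      using deriv_e by (intro has_vector_derivative_sum)
        (auto intro!: derivative_eq_intros simp: matrix_matrix_mult_def)
    then show "(?E has_vector_derivative A ** ?E t) (at t)"
      unfolding E_eq D_eq .
  qed
qed

text \<open>Skewness makes the two terms in the derivative of \<open>transpose (E t) ** E t\<close>
  cancel, so this product keeps its value at 0.\<close>

lemma skew_matrix_smooth_rotation:
  fixes A :: "real^'n^'n"
  assumes "transpose A = - A"
  obtains E where "Cinf_on UNIV E" "E 0 = mat 1" "(E has_vector_derivative A) (at 0)"
    "\<And>t. transpose (E t) ** E t = mat 1"
proof -
  obtain E where E: "E 0 = mat 1" "\<And>t. (E has_vector_derivative A ** E t) (at t)"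
    using matrix_linear_ode_solution by blast
  have smooth: "Cinf_on UNIV E"
    using Cinf_on_linear_ode[OF
        bounded_bilinear.bounded_linear_right[OF bounded_bilinear_matrix_matrix_mult] E(2)] .
  have "((\<lambda>t. transpose (E t) ** E t) has_vector_derivative
      transpose (E t) ** (A ** E t) + transpose (A ** E t) ** E t) (at t)" for t
    by (intro bounded_bilinear.has_vector_derivative[OF bounded_bilinear_matrix_matrix_mult]
        bounded_linear.has_vector_derivative[OF bounded_linear_transpose] E(2))
  then have "((\<lambda>t. transpose (E t) ** E t) has_vector_derivative 0) (at t)" for t
    by (simp add: transpose_simps assms matrix_mult_simps matrix_mul_assoc)
  then have "((\<lambda>t. transpose (E t) ** E t) has_derivative (\<lambda>_. 0)) (at t within UNIV)" for t
    by (simp add: has_vector_derivative_def)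
  then obtain C where "transpose (E t) ** E t = C" for t
    using has_derivative_zero_constant[of UNIV "\<lambda>t. transpose (E t) ** E t"] by auto
  then have "transpose (E t) ** E t = mat 1" for t
    using E(1) by (metis matrix_mul_lid transpose_mat)
  then show ?thesis
    using that smooth E(1) E(2)[of 0] by simp
qed

section \<open>Tangent spaces of the Grassmannian\<close>

lemma Gr_iff:
  "Q \<in> Gr k \<longleftrightarrow> transpose Q = Q \<and> Q ** Q = mat 1 \<and> trace Q = 2 * real k - real CARD('n)"
  for Q :: "real^'n^'n"
  by (auto simp: Gr_def orthogonal_matrix_def)

lemma Gr_conjugate:
  fixes E Q :: "real^'n^'n"
  assumes "Q \<in> Gr k" "transpose E ** E = mat 1"
  shows "E ** Q ** transpose E \<in> Gr k"
proof -
  have "E ** Q ** transpose E ** (E ** Q ** transpose E)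
      = E ** Q ** (transpose E ** E) ** Q ** transpose E"
    by (simp only: matrix_mul_assoc)
  also have "\<dots> = E ** (Q ** Q) ** transpose E"
    by (simp add: assms(2) matrix_mul_assoc)
  also have "\<dots> = mat 1"
    using assms matrix_left_right_inverse[of E "transpose E"] by (simp add: Gr_iff)
  finally have "E ** Q ** transpose E ** (E ** Q ** transpose E) = mat 1" .
  moreover have "trace (E ** Q ** transpose E) = trace Q"
    using trace_mul_sym[of "E ** Q" "transpose E"] assms(2) by (simp add: matrix_mul_assoc)
  ultimately show ?thesis
    using assms(1) by (simp add: Gr_iff transpose_simps matrix_mul_assoc)
qed

lemma tangent_space_Gr:
  assumes Q: "Q \<in> Gr k"
  shows "tangent_space (Gr k) Q = {X. transpose X = X \<and> X ** Q + Q ** X = 0}"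
proof (intro equalityI subsetI)
  fix X assume "X \<in> tangent_space (Gr k) Q"
  then obtain c e where c: "e > 0" "c ` {-e<..<e} \<subseteq> Gr k" "c 0 = Q" "(c has_vector_derivative X) (at 0)"
    unfolding tangent_space_def curve_through_def by blast
  \<comment> \<open>Any matrix function that is constant on \<open>Gr k\<close> has zero derivative
    along \<open>c\<close>; it is applied to the two defining equations, symmetry and
    \<open>q ** q = mat 1\<close>.\<close>
  have const: "D = 0" if "(F has_vector_derivative D) (at 0)" "\<And>Q. Q \<in> Gr k \<Longrightarrow> G Q = z" "\<And>t. F t = G (c t)"
    for F :: "real \<Rightarrow> real^'n^'n" and D G z
  proof -
    have "(F has_vector_derivative 0) (at 0)"
      by (rule has_vector_derivative_transform_within_open[of "\<lambda>_. z" _ _ "{-e<..<e}"])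
        (use c that in \<open>auto simp: image_subset_iff\<close>)
    then show ?thesis using that(1) vector_derivative_unique_at by blast
  qed
  have "((\<lambda>t. transpose (c t) - c t) has_vector_derivative transpose X - X) (at 0)"
    by (intro has_vector_derivative_diff bounded_linear.has_vector_derivative[OF bounded_linear_transpose] c)
  from const[OF this, of "\<lambda>q. transpose q - q" 0] have "transpose X = X"
    by (simp add: Gr_iff)
  moreover have "((\<lambda>t. c t ** c t) has_vector_derivative c 0 ** X + X ** c 0) (at 0)"
    by (intro bounded_bilinear.has_vector_derivative[OF bounded_bilinear_matrix_matrix_mult] c)
  from const[OF this, of "\<lambda>q. q ** q" "mat 1"] have "X ** Q + Q ** X = 0"
    by (simp add: Gr_iff c(3) add.commute)
  ultimately show "X \<in> {X. transpose X = X \<and> X ** Q + Q ** X = 0}" by simp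
next
  fix X assume "X \<in> {X. transpose X = X \<and> X ** Q + Q ** X = 0}"
  then have X: "transpose X = X" "Q ** X = - (X ** Q)"
    by (auto simp: eq_neg_iff_add_eq_0 add.commute)
  have Q': "transpose Q = Q" "Q ** Q = mat 1" using Q by (auto simp: Gr_iff)
  \<comment> \<open>At 0 the conjugated curve has velocity \<open>A Q + Q A^T\<close>. Each summand
    equals half of \<open>X\<close>, which fixes the factor 1/2.\<close>
  define A where "A = (1/2) *\<^sub>R (X ** Q)"
  have skew: "transpose A = - A"
    by (simp add: A_def transpose_simps X Q')
  obtain E where E: "Cinf_on UNIV E" "E 0 = mat 1" "(E has_vector_derivative A) (at 0)"
    "\<And>t. transpose (E t) ** E t = mat 1"
    using skew_matrix_smooth_rotation[OF skew] by blast
  let ?c = "\<lambda>t. E t ** Q ** transpose (E t)"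
  have "Cinf_on UNIV ?c"
    by (intro Cinf_on_bilinear[OF bounded_bilinear_matrix_matrix_mult] E(1) Cinf_on_const
        Cinf_on_linear[OF bounded_linear_transpose] open_UNIV)
  moreover have "(?c has_vector_derivative
      E 0 ** Q ** transpose A + (E 0 ** 0 + A ** Q) ** transpose (E 0)) (at 0)"
    by (intro bounded_bilinear.has_vector_derivative[OF bounded_bilinear_matrix_matrix_mult]
        bounded_linear.has_vector_derivative[OF bounded_linear_transpose] E(3) has_vector_derivative_const)
  moreover have "E 0 ** Q ** transpose A + (E 0 ** 0 + A ** Q) ** transpose (E 0) = X"
  proof -
    have "A ** Q = (1/2) *\<^sub>R X"
      by (simp add: A_def matrix_mult_simps Q' flip: matrix_mul_assoc)
    moreover have "transpose A = (1/2) *\<^sub>R (Q ** X)"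
      by (simp add: A_def transpose_simps X(1) Q')
    then have "Q ** transpose A = (1/2) *\<^sub>R X"
      by (simp add: matrix_mult_simps Q' matrix_mul_assoc)
    ultimately show ?thesis
      by (simp add: E(2))
  qed
  moreover have "?c t \<in> Gr k" for t
    using Gr_conjugate[OF Q E(4)] .
  ultimately have "curve_through (Gr k) Q X ?c"
    unfolding curve_through_def
    using Cinf_on_subset[of UNIV ?c "{-1<..<1}"] E(2)
    by (auto intro!: exI[of _ "1::real"])
  then show "X \<in> tangent_space (Gr k) Q" unfolding tangent_space_def by blast
qed

text \<open>For \<open>q\<close> in \<open>Gr k\<close>, sending \<open>W\<close> to
  \<open>- (q ** W ** q)\<close> is an involution whose symmetric fixed points are exactly the
  tangent vectors; \<open>gr_proj\<close> averages \<open>W\<close> with its image.\<close>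

definition gr_proj :: "real^'n^'n \<Rightarrow> real^'n^'n \<Rightarrow> real^'n^'n" where
  "gr_proj q W = (1/2) *\<^sub>R (W - q ** W ** q)"

lemma gr_proj_tangent:
  assumes "q \<in> Gr k" "transpose W = W"
  shows "gr_proj q W \<in> tangent_space (Gr k) q"
  using assms unfolding tangent_space_Gr[OF assms(1)] gr_proj_def Gr_iff
  by (simp add: transpose_simps matrix_mult_simps matrix_mul_assoc)
    (simp add: matrix_mult_simps algebra_simps flip: matrix_mul_assoc)

lemma gr_proj_ident:
  assumes "q \<in> Gr k" "X \<in> tangent_space (Gr k) q"
  shows "gr_proj q X = X"
proof -
  have "q ** X = - (X ** q)" "q ** q = mat 1"
    using assms by (auto simp: tangent_space_Gr Gr_iff eq_neg_iff_add_eq_0 add.commute)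
  then have "q ** X ** q = - X"
    by (simp add: matrix_mult_simps flip: matrix_mul_assoc)
  then show ?thesis by (simp add: gr_proj_def)
qed

text \<open>Cyclicity of the trace moves the outer \<open>q\<close> over to \<open>Z\<close>, and
  conjugating a tangent \<open>Z\<close> by \<open>q\<close> flips its sign. Hence the part removed
  by \<open>gr_proj\<close> is orthogonal to the tangent space.\<close>

lemma trace_gr_proj:
  assumes "q \<in> Gr k" "Z \<in> tangent_space (Gr k) q"
  shows "trace (gr_proj q W ** Z) = trace (W ** Z)"
proof -
  have q: "q ** Z = - (Z ** q)" "q ** q = mat 1"
    using assms by (auto simp: tangent_space_Gr Gr_iff eq_neg_iff_add_eq_0 add.commute)
  have "trace (q ** W ** q ** Z) = trace (W ** (q ** Z ** q))"
    using trace_mul_sym[of q "W ** q ** Z"] by (simp add: matrix_mul_assoc)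
  also have "\<dots> = - trace (W ** Z)"
    by (simp add: q matrix_mult_simps trace_simps flip: matrix_mul_assoc)
  finally show ?thesis
    by (simp add: gr_proj_def matrix_mult_simps trace_simps)
qed

lemma Cinf_on_gr_proj:
  assumes "open U" "Cinf_on U W"
  shows "Cinf_on U (\<lambda>q. gr_proj q (W q))"
  unfolding gr_proj_def
  by (intro Cinf_on_linear[OF bounded_linear_scaleR_right] Cinf_on_diff
      Cinf_on_bilinear[OF bounded_bilinear_matrix_matrix_mult] Cinf_on_ident assms)

section \<open>Derivatives of vector fields\<close>

lemma smooth_on_sub_extension:
  assumes "smooth_on_sub M f" "p \<in> M"
  obtains V h where "open V" "p \<in> V" "Cinf_on V h" "\<And>q. q \<in> M \<Longrightarrow> q \<in> V \<Longrightarrow> f q = h q"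
  using assms unfolding smooth_on_sub_def by (metis IntI)

lemma smooth_on_subI:
  assumes "\<And>p. p \<in> M \<Longrightarrow>
    \<exists>V h. open V \<and> p \<in> V \<and> Cinf_on V h \<and> (\<forall>q. q \<in> M \<longrightarrow> q \<in> V \<longrightarrow> f q = h q)"
  shows "smooth_on_sub M f"
  unfolding smooth_on_sub_def using assms by (metis IntE)

lemma smooth_on_sub_Cinf_on: "Cinf_on UNIV f \<Longrightarrow> smooth_on_sub M f"
  by (rule smooth_on_subI) (auto intro!: exI[of _ UNIV] exI[of _ f])

lemma vector_field_extension:
  assumes "vector_field M X" "p \<in> M"
  obtains V h where "open V" "p \<in> V" "Cinf_on V h" "\<And>q. q \<in> M \<Longrightarrow> q \<in> V \<Longrightarrow> X q = h q"
  using assms smooth_on_sub_extension unfolding vector_field_def by blast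

lemma vector_field_tangent: "vector_field M X \<Longrightarrow> p \<in> M \<Longrightarrow> X p \<in> tangent_space M p"
  by (simp add: vector_field_def)

text \<open>The flat derivative of a field known only on \<open>M\<close>. Taking it componentwise
  through \<open>tderiv\<close> makes it independent of any choice of extension.\<close>

definition field_along ::
    "'a::euclidean_space set \<Rightarrow> ('a \<Rightarrow> 'b::euclidean_space) \<Rightarrow> 'a \<Rightarrow> 'a \<Rightarrow> 'b" where
  "field_along M Y p x = (\<Sum>b\<in>Basis. tderiv M (\<lambda>q. Y q \<bullet> b) p x *\<^sub>R b)"

lemma field_along_eq:
  assumes "open V" "p \<in> V" "\<And>q. q \<in> M \<Longrightarrow> q \<in> V \<Longrightarrow> Y q = h q"
    and "(h has_derivative h') (at p)" "x \<in> tangent_space M p"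
  shows "field_along M Y p x = h' x"
proof -
  have "tderiv M (\<lambda>q. Y q \<bullet> b) p x = h' x \<bullet> b" for b
    by (rule tderiv_eq[OF assms(1,2) _ has_derivative_inner_left[OF assms(4)] assms(5)])
      (simp add: assms(3))
  then show ?thesis by (simp add: field_along_def euclidean_representation)
qed

text \<open>Separating \<open>\<phi>\<close> from its extension \<open>f\<close> serves two uses:
  smooth functions with local extensions in the torsion identity, and the given function of class
  \<open>C\<^sup>2\<close> in the Hessian.\<close>

lemma field_deriv_field_deriv:
  assumes "open U" "p \<in> U" "p \<in> M" "Ck_on 2 U f"
    and \<phi>: "\<And>q. q \<in> M \<Longrightarrow> q \<in> U \<Longrightarrow> \<phi> q = f q"
    and X: "vector_field M X" and Y: "vector_field M Y"
  shows "field_deriv M X (field_deriv M Y \<phi>) p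
    = frechet_derivative (\<lambda>q. frechet_derivative f (at q) (Y p)) (at p) (X p)
      + frechet_derivative f (at p) (field_along M Y p (X p))"
proof -
  obtain V h where h: "open V" "p \<in> V" "Cinf_on V h" "\<And>q. q \<in> M \<Longrightarrow> q \<in> V \<Longrightarrow> Y q = h q"
    using vector_field_extension[OF Y assms(3)] by blast
  let ?h' = "frechet_derivative h (at p)"
  have f: "(f has_derivative frechet_derivative f (at q)) (at q)" if "q \<in> U" for q
    using Ck_on_Suc_has_derivative[of 1 U f q] assms(4) that by (simp only: Suc_1)
  have x: "X p \<in> tangent_space M p"
    using vector_field_tangent[OF X assms(3)] .
  \<comment> \<open>Before it can be differentiated again, \<open>Y \<phi>\<close> must be matched
    on \<open>M\<close> with a function that is differentiable on an ambient neighbourhood.\<close>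
  have "field_deriv M Y \<phi> q = frechet_derivative f (at q) (h q)" if "q \<in> M" "q \<in> U \<inter> V" for q
    unfolding field_deriv_def
    using tderiv_eq[of U q M \<phi> f _ "Y q", OF assms(1) _ \<phi> f vector_field_tangent[OF Y]] h(4) that
    by auto
  then have "field_deriv M X (field_deriv M Y \<phi>) p
    = frechet_derivative (\<lambda>q. frechet_derivative f (at q) (h p)) (at p) (X p)
      + frechet_derivative f (at p) (?h' (X p))"
    unfolding field_deriv_def[of M X]
    by (intro tderiv_eq[of "U \<inter> V", OF _ _ _ has_derivative_frechet_derivative_field[OF
          assms(1,2,4) Cinf_on_has_derivative[OF h(3,2)]] x])
      (use assms(1,2) h(1,2) in auto)
  moreover have "field_along M Y p (X p) = ?h' (X p)"
    by (rule field_along_eq[OF h(1,2,4) Cinf_on_has_derivative[OF h(3,2)] x])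
  ultimately show ?thesis
    using h(2,4) assms(3) by simp
qed

text \<open>The equations cutting out the tangent spaces hold along the whole field \<open>Y\<close>, so their
  derivatives in the direction \<open>x\<close> vanish.\<close>

lemma field_along_Gr:
  fixes Y :: "real^'n^'n \<Rightarrow> real^'n^'n"
  assumes p: "p \<in> Gr k" and Y: "vector_field (Gr k) Y" and x: "x \<in> tangent_space (Gr k) p"
  shows "transpose (field_along (Gr k) Y p x) = field_along (Gr k) Y p x"
    and "field_along (Gr k) Y p x ** p + p ** field_along (Gr k) Y p x = - (x ** Y p + Y p ** x)"
proof -
  obtain V h where h: "open V" "p \<in> V" "Cinf_on V h" "\<And>q. q \<in> Gr k \<Longrightarrow> q \<in> V \<Longrightarrow> Y q = h q"
    using vector_field_extension[OF Y p] by blast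
  let ?h' = "frechet_derivative h (at p)"
  note dh = Cinf_on_has_derivative[OF h(3,2)]
  have W: "field_along (Gr k) Y p x = ?h' x"
    by (rule field_along_eq[OF h(1,2,4) dh x])
  have Yq: "transpose (Y q) = Y q" "Y q ** q + q ** Y q = 0" if "q \<in> Gr k" for q
    using vector_field_tangent[OF Y that] tangent_space_Gr[OF that] by auto
  have zero: "field_along (Gr k) Z p x = 0" if "\<And>q. q \<in> Gr k \<Longrightarrow> Z q = 0"
    for Z :: "real^'n^'n \<Rightarrow> real^'n^'n"
    using field_along_eq[of UNIV p "Gr k" Z "\<lambda>_. 0", OF _ _ _ has_derivative_const x] that by simp
  have "field_along (Gr k) (\<lambda>q. transpose (Y q) - Y q) p x = transpose (?h' x) - ?h' x"
    by (rule field_along_eq[OF h(1,2) _ has_derivative_diff[OF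
          bounded_linear.has_derivative[OF bounded_linear_transpose dh] dh] x]) (simp add: h(4))
  then show "transpose (field_along (Gr k) Y p x) = field_along (Gr k) Y p x"
    using zero[of "\<lambda>q. transpose (Y q) - Y q"] Yq(1) by (simp add: W)
  have "field_along (Gr k) (\<lambda>q. Y q ** q + q ** Y q) p x
      = (h p ** x + ?h' x ** p) + (p ** ?h' x + x ** h p)"
    by (rule field_along_eq[OF h(1,2) _ has_derivative_add[OF
          bounded_bilinear.FDERIV[OF bounded_bilinear_matrix_matrix_mult dh has_derivative_ident]
          bounded_bilinear.FDERIV[OF bounded_bilinear_matrix_matrix_mult has_derivative_ident dh]] x])
      (simp add: h(4))
  then have "(h p ** x + ?h' x ** p) + (p ** ?h' x + x ** h p) = 0"
    using zero[of "\<lambda>q. Y q ** q + q ** Y q"] Yq(2) by simp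
  then show "field_along (Gr k) Y p x ** p + p ** field_along (Gr k) Y p x = - (x ** Y p + Y p ** x)"
    unfolding W eq_neg_iff_add_eq_0 h(4)[OF p h(2)] by (simp add: add_ac)
qed

section \<open>The Levi-Civita connection of the Grassmannian\<close>

definition gr_connection ::
    "nat \<Rightarrow> (real^'n^'n \<Rightarrow> real^'n^'n) \<Rightarrow> (real^'n^'n \<Rightarrow> real^'n^'n) \<Rightarrow> real^'n^'n \<Rightarrow> real^'n^'n"
  where "gr_connection k X Y q = gr_proj q (field_along (Gr k) Y q (X q))"

text \<open>The normal part of the flat derivative is the second fundamental form of \<open>Gr k\<close>; it is
  symmetric in \<open>X\<close> and \<open>Y\<close>, and it is the source of the correction term in the Hessian.\<close>

lemma gr_connection_normal_part:
  assumes p: "p \<in> Gr k" and X: "vector_field (Gr k) X" and Y: "vector_field (Gr k) Y"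
  shows "field_along (Gr k) Y p (X p)
    = gr_connection k X Y p - (1/2) *\<^sub>R (p ** (X p ** Y p + Y p ** X p))"
proof -
  let ?W = "field_along (Gr k) Y p (X p)"
  have pp: "p ** p = mat 1" using p by (simp add: Gr_iff)
  have "?W ** p + p ** ?W = - (X p ** Y p + Y p ** X p)"
    by (rule field_along_Gr(2)[OF p Y vector_field_tangent[OF X p]])
  then have "p ** (X p ** Y p + Y p ** X p) = - (p ** (?W ** p + p ** ?W))"
    by (simp add: matrix_mult_simps)
  also have "\<dots> = - (?W + p ** ?W ** p)"
    by (simp add: matrix_mult_simps matrix_mul_assoc pp add.commute)
  finally have e: "p ** (X p ** Y p + Y p ** X p) = - (?W + p ** ?W ** p)" .
  have "(1/2) *\<^sub>R (?W - p ** ?W ** p) - (1/2) *\<^sub>R (- (?W + p ** ?W ** p)) = ?W"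
    by (simp add: algebra_simps flip: scaleR_left.add)
  then show ?thesis
    unfolding gr_connection_def gr_proj_def e by simp
qed

lemma vector_field_gr_connection:
  fixes X Y :: "real^'n^'n \<Rightarrow> real^'n^'n"
  assumes X: "vector_field (Gr k) X" and Y: "vector_field (Gr k) Y"
  shows "vector_field (Gr k) (gr_connection k X Y)"
  unfolding vector_field_def
proof
  show "\<forall>p\<in>Gr k. gr_connection k X Y p \<in> tangent_space (Gr k) p"
    unfolding gr_connection_def
    using gr_proj_tangent field_along_Gr(1)[OF _ Y vector_field_tangent[OF X]] by blast
  show "smooth_on_sub (Gr k) (gr_connection k X Y)"
  proof (rule smooth_on_subI)
    fix p :: "real^'n^'n" assume p: "p \<in> Gr k"
    obtain V g where g: "open V" "p \<in> V" "Cinf_on V g" "\<And>q. q \<in> Gr k \<Longrightarrow> q \<in> V \<Longrightarrow> X q = g q"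
      using vector_field_extension[OF X p] by blast
    obtain U h where h: "open U" "p \<in> U" "Cinf_on U h" "\<And>q. q \<in> Gr k \<Longrightarrow> q \<in> U \<Longrightarrow> Y q = h q"
      using vector_field_extension[OF Y p] by blast
    \<comment> \<open>This expression also makes sense off \<open>Gr k\<close>:
      \<open>gr_proj\<close> is polynomial in \<open>q\<close>, and the local extensions replace
      both fields.\<close>
    let ?H = "\<lambda>q. gr_proj q (frechet_derivative h (at q) (g q))"
    have "gr_connection k X Y q = ?H q" if "q \<in> Gr k" "q \<in> V \<inter> U" for q
      using field_along_eq[OF h(1) _ h(4) Cinf_on_has_derivative[OF h(3)]
          vector_field_tangent[OF X that(1)]] g(4) that
      by (simp add: gr_connection_def)
    moreover have "Cinf_on (V \<inter> U) ?H"
      using g(1,3) h(1,3) by (intro Cinf_on_gr_proj Cinf_on_frechet_derivative_field)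
        (auto intro: Cinf_on_subset)
    ultimately show "\<exists>W H. open W \<and> p \<in> W \<and> Cinf_on W H \<and>
        (\<forall>q. q \<in> Gr k \<longrightarrow> q \<in> W \<longrightarrow> gr_connection k X Y q = H q)"
      using g h by (intro exI[of _ "V \<inter> U"] exI[of _ ?H]) auto
  qed
qed

section \<open>Linearity and Leibniz rules behind the connection axioms\<close>

lemma gr_proj_add: "gr_proj q (V + W) = gr_proj q V + gr_proj q W"
  by (simp add: gr_proj_def matrix_mult_simps algebra_simps)

lemma gr_proj_scaleR: "gr_proj q (a *\<^sub>R W) = a *\<^sub>R gr_proj q W"
  by (simp add: gr_proj_def matrix_mult_simps algebra_simps)

lemma tangent_space_Gr_add:
  assumes "q \<in> Gr k" "x \<in> tangent_space (Gr k) q" "y \<in> tangent_space (Gr k) q"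
  shows "x + y \<in> tangent_space (Gr k) q"
  using assms by (auto simp: tangent_space_Gr transpose_simps matrix_mult_simps)
    (metis (no_types, lifting) add.assoc add.commute add.right_neutral)

lemma tangent_space_Gr_scaleR:
  assumes "q \<in> Gr k" "x \<in> tangent_space (Gr k) q"
  shows "a *\<^sub>R x \<in> tangent_space (Gr k) q"
  using assms by (auto simp: tangent_space_Gr transpose_simps matrix_mult_simps simp flip: scaleR_right.add)

text \<open>\<open>field_along\<close> is computed by an extension's derivative only in tangent
  directions, so linearity in the direction rests on the tangent space of \<open>Gr k\<close> being
  closed under sums and multiples.\<close>

lemma field_along_linear_on_tangent_space:
  assumes p: "p \<in> Gr k" and Y: "vector_field (Gr k) Y" and x: "x \<in> tangent_space (Gr k) p"
  shows field_along_add_right: "y \<in> tangent_space (Gr k) p \<Longrightarrow>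
      field_along (Gr k) Y p (x + y) = field_along (Gr k) Y p x + field_along (Gr k) Y p y"
    and field_along_scaleR_right:
      "field_along (Gr k) Y p (a *\<^sub>R x) = a *\<^sub>R field_along (Gr k) Y p x"
proof -
  obtain V h where h: "open V" "p \<in> V" "Cinf_on V h" "\<And>q. q \<in> Gr k \<Longrightarrow> q \<in> V \<Longrightarrow> Y q = h q"
    using vector_field_extension[OF Y p] by blast
  have eq: "field_along (Gr k) Y p z = frechet_derivative h (at p) z"
    if "z \<in> tangent_space (Gr k) p" for z
    by (rule field_along_eq[OF h(1,2,4) Cinf_on_has_derivative[OF h(3,2)] that])
  have lin: "linear (frechet_derivative h (at p))"
    using linear_frechet_derivative Cinf_on_differentiable[OF h(3,2)] by blast
  show "field_along (Gr k) Y p (x + y) = field_along (Gr k) Y p x + field_along (Gr k) Y p y"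
    if "y \<in> tangent_space (Gr k) p"
    using x that p by (simp add: eq tangent_space_Gr_add linear_add[OF lin])
  show "field_along (Gr k) Y p (a *\<^sub>R x) = a *\<^sub>R field_along (Gr k) Y p x"
    using x p by (simp add: eq tangent_space_Gr_scaleR linear_scale[OF lin])
qed

lemma field_along_add:
  assumes p: "p \<in> M" and "vector_field M Y" "vector_field M Z" and x: "x \<in> tangent_space M p"
  shows "field_along M (\<lambda>q. Y q + Z q) p x = field_along M Y p x + field_along M Z p x"
proof -
  obtain V g where g: "open V" "p \<in> V" "Cinf_on V g" "\<And>q. q \<in> M \<Longrightarrow> q \<in> V \<Longrightarrow> Y q = g q"
    using vector_field_extension[OF assms(2) p] by blast
  obtain U h where h: "open U" "p \<in> U" "Cinf_on U h" "\<And>q. q \<in> M \<Longrightarrow> q \<in> U \<Longrightarrow> Z q = h q"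
    using vector_field_extension[OF assms(3) p] by blast
  note dg = Cinf_on_has_derivative[OF g(3,2)] and dh = Cinf_on_has_derivative[OF h(3,2)]
  have Y: "field_along M Y p x = frechet_derivative g (at p) x"
    by (rule field_along_eq[OF g(1,2,4) dg x])
  have Z: "field_along M Z p x = frechet_derivative h (at p) x"
    by (rule field_along_eq[OF h(1,2,4) dh x])
  show ?thesis
    unfolding Y Z
    by (rule field_along_eq[OF open_Int[OF g(1) h(1)] _ _ has_derivative_add[OF dg dh] x])
      (use g h in auto)
qed

lemma field_along_scaleR:
  assumes p: "p \<in> M" and "smooth_on_sub M \<phi>" "vector_field M Y" and x: "x \<in> tangent_space M p"
  shows "field_along M (\<lambda>q. \<phi> q *\<^sub>R Y q) p x = tderiv M \<phi> p x *\<^sub>R Y p + \<phi> p *\<^sub>R field_along M Y p x"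
proof -
  obtain V g where g: "open V" "p \<in> V" "Cinf_on V g" "\<And>q. q \<in> M \<Longrightarrow> q \<in> V \<Longrightarrow> \<phi> q = g q"
    using smooth_on_sub_extension[OF assms(2) p] by blast
  obtain U h where h: "open U" "p \<in> U" "Cinf_on U h" "\<And>q. q \<in> M \<Longrightarrow> q \<in> U \<Longrightarrow> Y q = h q"
    using vector_field_extension[OF assms(3) p] by blast
  note dg = Cinf_on_has_derivative[OF g(3,2)] and dh = Cinf_on_has_derivative[OF h(3,2)]
  have "field_along M (\<lambda>q. \<phi> q *\<^sub>R Y q) p x
      = g p *\<^sub>R frechet_derivative h (at p) x + frechet_derivative g (at p) x *\<^sub>R h p"
    by (rule field_along_eq[OF open_Int[OF g(1) h(1)] _ _ has_derivative_scaleR[OF dg dh] x])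
      (use g h in auto)
  moreover have "tderiv M \<phi> p x = frechet_derivative g (at p) x"
    by (rule tderiv_eq[OF g(1,2,4) dg x])
  moreover have "field_along M Y p x = frechet_derivative h (at p) x"
    by (rule field_along_eq[OF h(1,2,4) dh x])
  ultimately show ?thesis
    using g(2,4) h(2,4) p by (simp add: add.commute)
qed

lemma field_along_cong:
  assumes p: "p \<in> M" and Y: "vector_field M Y" and "\<And>q. q \<in> M \<Longrightarrow> Y q = Z q"
    and x: "x \<in> tangent_space M p"
  shows "field_along M Y p x = field_along M Z p x"
proof -
  obtain U h where h: "open U" "p \<in> U" "Cinf_on U h" "\<And>q. q \<in> M \<Longrightarrow> q \<in> U \<Longrightarrow> Y q = h q"
    using vector_field_extension[OF Y p] by blast
  note dh = Cinf_on_has_derivative[OF h(3,2)]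
  have "field_along M Z p x = frechet_derivative h (at p) x"
    by (rule field_along_eq[OF h(1,2) _ dh x]) (use h(4) assms(3) in auto)
  moreover have "field_along M Y p x = frechet_derivative h (at p) x"
    by (rule field_along_eq[OF h(1,2,4) dh x])
  ultimately show ?thesis by simp
qed

lemma affine_connection_gr_connection: "affine_connection (Gr k :: (real^'n^'n) set) (gr_connection k)"
  unfolding affine_connection_def
proof (intro conjI allI impI ballI)
  fix X X' Y Y' :: "real^'n^'n \<Rightarrow> real^'n^'n" and p :: "real^'n^'n"
  assume "vector_field (Gr k) X" "vector_field (Gr k) Y" "p \<in> Gr k"
    "\<forall>q\<in>Gr k. X q = X' q" "\<forall>q\<in>Gr k. Y q = Y' q"
  then show "gr_connection k X Y p = gr_connection k X' Y' p"
    unfolding gr_connection_def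
    using field_along_cong[of p "Gr k" Y Y' "X p"] vector_field_tangent by metis
\<comment> \<open>In the Leibniz rule the term with the derivative of \<open>\<phi>\<close> is a
  multiple of \<open>Y p\<close>, which is tangent and therefore fixed by
  \<open>gr_proj\<close>.\<close>
qed (simp_all add: vector_field_gr_connection gr_connection_def field_along_add_right field_along_scaleR_right
    field_along_add field_along_scaleR field_deriv_def vector_field_tangent gr_proj_add gr_proj_scaleR gr_proj_ident)

lemma metric_compatible_gr_connection: "metric_compatible (Gr k :: (real^'n^'n) set) Gr_metric (gr_connection k)"
  unfolding metric_compatible_def
proof (intro allI impI ballI)
  fix X Y Z :: "real^'n^'n \<Rightarrow> real^'n^'n" and p :: "real^'n^'n"
  assume X: "vector_field (Gr k) X" and Y: "vector_field (Gr k) Y" and Z: "vector_field (Gr k) Z"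
    and p: "p \<in> Gr k"
  obtain V g where g: "open V" "p \<in> V" "Cinf_on V g" "\<And>q. q \<in> Gr k \<Longrightarrow> q \<in> V \<Longrightarrow> Y q = g q"
    using vector_field_extension[OF Y p] by blast
  obtain U h where h: "open U" "p \<in> U" "Cinf_on U h" "\<And>q. q \<in> Gr k \<Longrightarrow> q \<in> U \<Longrightarrow> Z q = h q"
    using vector_field_extension[OF Z p] by blast
  note dg = Cinf_on_has_derivative[OF g(3,2)] and dh = Cinf_on_has_derivative[OF h(3,2)]
  note tangent = vector_field_tangent[OF X p] vector_field_tangent[OF Y p] vector_field_tangent[OF Z p]
  have "field_deriv (Gr k) X (\<lambda>q. Gr_metric q (Y q) (Z q)) p
      = trace (g p ** frechet_derivative h (at p) (X p) + frechet_derivative g (at p) (X p) ** h p)"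
    unfolding field_deriv_def Gr_metric_def
    by (rule tderiv_eq[OF open_Int[OF g(1) h(1)] _ _ bounded_linear.has_derivative[OF bounded_linear_trace
            bounded_bilinear.FDERIV[OF bounded_bilinear_matrix_matrix_mult dg dh]] tangent(1)])
      (use g h in auto)
  also have "frechet_derivative g (at p) (X p) = field_along (Gr k) Y p (X p)"
    by (rule field_along_eq[OF g(1,2,4) dg tangent(1), symmetric])
  also have "frechet_derivative h (at p) (X p) = field_along (Gr k) Z p (X p)"
    by (rule field_along_eq[OF h(1,2,4) dh tangent(1), symmetric])
  also have "trace (g p ** field_along (Gr k) Z p (X p) + field_along (Gr k) Y p (X p) ** h p)
      = trace (Y p ** field_along (Gr k) Z p (X p)) + trace (field_along (Gr k) Y p (X p) ** Z p)"
    using g(2,4) h(2,4) p by (simp add: trace_simps)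
  \<comment> \<open>In each term the undifferentiated factor is tangent, so the trace does not
    notice the projection of the other one.\<close>
  also have "\<dots> = trace (Y p ** gr_connection k X Z p) + trace (gr_connection k X Y p ** Z p)"
    unfolding gr_connection_def trace_gr_proj[OF p tangent(3)] trace_mul_sym[of "Y p"]
      trace_gr_proj[OF p tangent(2)] ..
  finally show "field_deriv (Gr k) X (\<lambda>q. Gr_metric q (Y q) (Z q)) p
      = Gr_metric p (gr_connection k X Y p) (Z p) + Gr_metric p (Y p) (gr_connection k X Z p)"
    by (simp add: Gr_metric_def)
qed

text \<open>Two symmetries cancel in the commutator: equality of mixed derivatives removes the
  second-order terms, and the normal parts agree because \<open>X Y + Y X\<close> is symmetric in
  the two fields.\<close>

lemma torsion_free_gr_connection: "torsion_free (Gr k :: (real^'n^'n) set) (gr_connection k)"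
  unfolding torsion_free_def
proof (intro allI impI ballI)
  fix X Y :: "real^'n^'n \<Rightarrow> real^'n^'n" and \<phi> :: "real^'n^'n \<Rightarrow> real" and p :: "real^'n^'n"
  assume X: "vector_field (Gr k) X" and Y: "vector_field (Gr k) Y"
    and \<phi>: "smooth_on_sub (Gr k) \<phi>" and p: "p \<in> Gr k"
  obtain V f where f: "open V" "p \<in> V" "Cinf_on V f" "\<And>q. q \<in> Gr k \<Longrightarrow> q \<in> V \<Longrightarrow> \<phi> q = f q"
    using smooth_on_sub_extension[OF \<phi> p] by blast
  let ?f' = "frechet_derivative f (at p)"
  have lin: "linear ?f'"
    using linear_frechet_derivative Cinf_on_differentiable[OF f(3,2)] by blast
  have fd: "field_deriv (Gr k) Z \<phi> p = ?f' (Z p)" if "vector_field (Gr k) Z" for Z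
    unfolding field_deriv_def
    by (rule tderiv_eq[OF f(1,2,4) Cinf_on_has_derivative[OF f(3,2)] vector_field_tangent[OF that p]])
  have second: "field_deriv (Gr k) V (field_deriv (Gr k) W \<phi>) p
      = frechet_derivative (\<lambda>q. frechet_derivative f (at q) (W p)) (at p) (V p)
        + ?f' (field_along (Gr k) W p (V p))"
    if "vector_field (Gr k) V" "vector_field (Gr k) W" for V W
    by (rule field_deriv_field_deriv[OF f(1,2) p Cinf_onD[OF f(3)] f(4) that])
  have "field_deriv (Gr k) X (field_deriv (Gr k) Y \<phi>) p - field_deriv (Gr k) Y (field_deriv (Gr k) X \<phi>) p
      = ?f' (field_along (Gr k) Y p (X p)) - ?f' (field_along (Gr k) X p (Y p))"
    unfolding second[OF X Y] second[OF Y X]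
    using second_derivative_symmetric[OF f(1,2) Cinf_onD[OF f(3)], of "X p" "Y p"] by simp
  also have "\<dots> = ?f' (gr_connection k X Y p) - ?f' (gr_connection k Y X p)"
    unfolding linear_diff[OF lin, symmetric] gr_connection_normal_part[OF p X Y]
      gr_connection_normal_part[OF p Y X] by (simp add: add.commute)
  finally show "field_deriv (Gr k) (gr_connection k X Y) \<phi> p - field_deriv (Gr k) (gr_connection k Y X) \<phi> p
      = field_deriv (Gr k) X (field_deriv (Gr k) Y \<phi>) p - field_deriv (Gr k) Y (field_deriv (Gr k) X \<phi>) p"
    by (simp add: fd vector_field_gr_connection X Y)
qed

lemma is_levi_civita_gr_connection: "is_levi_civita (Gr k) Gr_metric (gr_connection k)"
  by (simp add: is_levi_civita_def affine_connection_gr_connection metric_compatible_gr_connection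
      torsion_free_gr_connection)

section \<open>Uniqueness of the Levi-Civita connection on the Grassmannian\<close>

lemma vector_field_gr_proj:
  assumes "transpose W = W"
  shows "vector_field (Gr k) (\<lambda>q. gr_proj q W)"
  unfolding vector_field_def
  using smooth_on_sub_Cinf_on[OF Cinf_on_gr_proj[OF open_UNIV Cinf_on_const]] gr_proj_tangent assms
  by blast

lemma affine_connection_vector_field:
  "affine_connection M D \<Longrightarrow> vector_field M X \<Longrightarrow> vector_field M Y \<Longrightarrow> vector_field M (D X Y)"
  unfolding affine_connection_def by (drule conjunct1) simp

text \<open>Torsion-freeness compares derivations. Testing on the coordinate function
  \<open>q \<bullet> b\<close> turns it into a statement about vectors whose right-hand side does
  not involve \<open>D\<close>.\<close>

lemma torsion_free_commutator:
  assumes "torsion_free M D" "affine_connection M D" "vector_field M X" "vector_field M Y" "p \<in> M"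
  shows "(D X Y p - D Y X p) \<bullet> b = field_deriv M X (field_deriv M Y (\<lambda>q. q \<bullet> b)) p
    - field_deriv M Y (field_deriv M X (\<lambda>q. q \<bullet> b)) p"
proof -
  have fd: "field_deriv M Z (\<lambda>q. q \<bullet> b) p = Z p \<bullet> b" if "vector_field M Z" for Z
    unfolding field_deriv_def
    by (rule tderiv_eq[OF open_UNIV UNIV_I _ has_derivative_inner_left[OF has_derivative_ident]
          vector_field_tangent[OF that assms(5)]]) simp
  have D: "vector_field M (D X Y)" "vector_field M (D Y X)"
    using assms(2-4) affine_connection_vector_field by blast+
  have "smooth_on_sub M (\<lambda>q. q \<bullet> b)"
    by (intro smooth_on_sub_Cinf_on Cinf_on_linear[OF bounded_linear_inner_left] Cinf_on_ident open_UNIV)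
  from assms(1)[unfolded torsion_free_def, rule_format, OF assms(3,4) this assms(5)]
  show ?thesis
    by (simp add: fd[OF D(1)] fd[OF D(2)] inner_diff_left)
qed

text \<open>Positive definiteness of the metric: for symmetric \<open>S\<close> the trace is the sum
  of the squares of the entries.\<close>

lemma trace_square_eq_0:
  fixes S :: "real^'n^'n"
  assumes "transpose S = S" "trace (S ** S) = 0"
  shows "S = 0"
proof -
  have "trace (transpose S ** S) = (\<Sum>i\<in>UNIV. \<Sum>j\<in>UNIV. (S $ j $ i)\<^sup>2)"
    by (simp add: trace_def matrix_matrix_mult_def transpose_def power2_eq_square)
  then have "(\<Sum>i\<in>UNIV. \<Sum>j\<in>UNIV. (S $ j $ i)\<^sup>2) = 0"
    using assms by simp
  then show ?thesis
    by (simp add: sum_nonneg_eq_0_iff sum_nonneg vec_eq_iff)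
qed

text \<open>The difference of two Levi-Civita connections is symmetric in its two arguments and
  skew with respect to the metric in the last two, hence zero.\<close>

lemma levi_civita_Gr_unique:
  fixes X Y :: "real^'n^'n \<Rightarrow> real^'n^'n"
  assumes D: "is_levi_civita (Gr k) Gr_metric D" and D': "is_levi_civita (Gr k) Gr_metric D'"
    and X: "vector_field (Gr k) X" and Y: "vector_field (Gr k) Y" and p: "p \<in> Gr k"
  shows "D X Y p = D' X Y p"
proof -
  define S where "S X Y = D X Y p - D' X Y p" for X Y
  define a where "a X Y Z = trace (S X Y ** Z p)" for X Y Z
  have S_commute: "S X Y = S Y X" if "vector_field (Gr k) X" "vector_field (Gr k) Y" for X Y
  proof -
    have "(D X Y p - D Y X p) \<bullet> b = (D' X Y p - D' Y X p) \<bullet> b" for b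
      using torsion_free_commutator[of "Gr k" D X Y p b] torsion_free_commutator[of "Gr k" D' X Y p b]
        D D' that p unfolding is_levi_civita_def by simp
    then have "D X Y p - D Y X p = D' X Y p - D' Y X p"
      by (metis euclidean_eqI)
    then show ?thesis by (simp add: S_def algebra_simps)
  qed
  have a_skew: "a X Y Z = - a X Z Y"
    if "vector_field (Gr k) X" "vector_field (Gr k) Y" "vector_field (Gr k) Z" for X Y Z
  proof -
    have "metric_compatible (Gr k) Gr_metric D" "metric_compatible (Gr k) Gr_metric D'"
      using D D' by (simp_all add: is_levi_civita_def)
    note compat = this[unfolded metric_compatible_def Gr_metric_def, rule_format, OF that p]
    have "trace (D X Y p ** Z p) + trace (Y p ** D X Z p) = trace (D' X Y p ** Z p) + trace (Y p ** D' X Z p)"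
      using compat by simp
    then show ?thesis
      using trace_mul_sym[of "Y p"] by (simp add: a_def S_def matrix_mult_simps trace_simps)
  qed
  have a_sym: "a X Y Z = a Y X Z" if "vector_field (Gr k) X" "vector_field (Gr k) Y" for X Y Z
    using S_commute that by (simp add: a_def)
  have "vector_field (Gr k) (D X Y)" "vector_field (Gr k) (D' X Y)"
    using D D' X Y affine_connection_vector_field unfolding is_levi_civita_def by blast+
  then have "S X Y \<in> tangent_space (Gr k) p"
    using tangent_space_Gr_add[OF p, of "D X Y p" "- D' X Y p"]
      tangent_space_Gr_scaleR[OF p, of "D' X Y p" "-1"] vector_field_tangent[OF _ p]
    by (simp add: S_def)
  then have sym: "transpose (S X Y) = S X Y" and proj: "gr_proj p (S X Y) = S X Y"
    using tangent_space_Gr[OF p] gr_proj_ident[OF p] by auto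
  \<comment> \<open>\<open>a\<close> takes fields as arguments, so the tangent vector
    \<open>S X Y\<close> is extended to a field in order to pair it with itself.\<close>
  let ?Z = "\<lambda>q. gr_proj q (S X Y)"
  have Z: "vector_field (Gr k) ?Z"
    using vector_field_gr_proj[OF sym] .
  \<comment> \<open>Alternating the two symmetries returns to the start after six swaps, and the
    three skew ones leave a minus sign.\<close>
  have "a X Y ?Z = - a X Y ?Z"
    using a_skew[OF X Y Z] a_sym[OF X Z] a_skew[OF Z X Y] a_sym[OF Z Y] a_skew[OF Y Z X] a_sym[OF X Y]
    by simp
  then have "trace (S X Y ** S X Y) = 0"
    by (simp add: a_def proj)
  then show ?thesis
    using trace_square_eq_0[OF sym] by (simp add: S_def)
qed

text \<open>\<open>gr_connection k\<close> witnesses that \<open>SOME\<close> selects a Levi-Civita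
  connection, and uniqueness then gives its values on vector fields.\<close>

lemma levi_civita_Gr:
  assumes "vector_field (Gr k) X" "vector_field (Gr k) Y" "p \<in> Gr k"
  shows "levi_civita (Gr k) Gr_metric X Y p = gr_connection k X Y p"
  using assms levi_civita_Gr_unique[OF _ is_levi_civita_gr_connection]
    someI[of "is_levi_civita (Gr k) Gr_metric", OF is_levi_civita_gr_connection]
  unfolding levi_civita_def by blast

section \<open>The Hessian\<close>

lemma riemannian_hessian_Gr:
  assumes U: "open U" "Gr k \<subseteq> U" "Ck_on 2 U f" and Q: "Q \<in> Gr k"
    and x: "x \<in> tangent_space (Gr k) Q" and y: "y \<in> tangent_space (Gr k) Q"
  shows "riemannian_hessian (Gr k) Gr_metric f Q x y
    = frechet_derivative (\<lambda>q. frechet_derivative f (at q) y) (at Q) x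
      - 1/2 * frechet_derivative f (at Q) (Q ** (x ** y + y ** x))" (is "_ = ?h")
proof -
  have QU: "Q \<in> U" using Q U by blast
  have f: "(f has_derivative frechet_derivative f (at Q)) (at Q)"
    using Ck_on_Suc_has_derivative[of 1 U f Q] U(3) QU by (simp only: Suc_1)
  then have lin: "linear (frechet_derivative f (at Q))"
    using has_derivative_linear by blast
  \<comment> \<open>The connection cancels the tangential part of the derivative of
    \<open>Y\<close>; what survives involves only the values \<open>x\<close> and \<open>y\<close>,
    so all extending fields give the same number.\<close>
  have h: "field_deriv (Gr k) X (field_deriv (Gr k) Y f) Q
      - field_deriv (Gr k) (levi_civita (Gr k) Gr_metric X Y) f Q = ?h"
    if "vector_field (Gr k) X" "vector_field (Gr k) Y" "X Q = x" "Y Q = y" for X Y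
  proof -
    have "field_deriv (Gr k) (levi_civita (Gr k) Gr_metric X Y) f Q
        = frechet_derivative f (at Q) (gr_connection k X Y Q)"
      unfolding field_deriv_def levi_civita_Gr[OF that(1,2) Q]
      by (rule tderiv_eq[OF U(1) QU refl f vector_field_tangent[OF vector_field_gr_connection[OF that(1,2)] Q]])
    then show ?thesis
      unfolding field_deriv_field_deriv[OF U(1) QU Q U(3) refl that(1,2)]
        gr_connection_normal_part[OF Q that(1,2)]
      unfolding that(3,4) by (simp add: linear_diff[OF lin] linear_scale[OF lin])
  qed
  \<comment> \<open>Some pair of extending fields must exist: otherwise every real number would
    satisfy the description of the Hessian.\<close>
  have ext: "vector_field (Gr k) (\<lambda>q. gr_proj q z) \<and> gr_proj Q z = z" if "z \<in> tangent_space (Gr k) Q" for z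
    using vector_field_gr_proj gr_proj_ident[OF Q that] that tangent_space_Gr[OF Q] by auto
  show ?thesis
    unfolding riemannian_hessian_def
  proof (rule the_equality)
    show "\<forall>X Y. vector_field (Gr k) X \<longrightarrow> vector_field (Gr k) Y \<longrightarrow> X Q = x \<longrightarrow> Y Q = y \<longrightarrow>
      ?h = field_deriv (Gr k) X (field_deriv (Gr k) Y f) Q
        - field_deriv (Gr k) (levi_civita (Gr k) Gr_metric X Y) f Q"
      using h by metis
  next
    fix h'
    assume "\<forall>X Y. vector_field (Gr k) X \<longrightarrow> vector_field (Gr k) Y \<longrightarrow> X Q = x \<longrightarrow> Y Q = y \<longrightarrow>
      h' = field_deriv (Gr k) X (field_deriv (Gr k) Y f) Q
        - field_deriv (Gr k) (levi_civita (Gr k) Gr_metric X Y) f Q"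
    from this[rule_format, of "\<lambda>q. gr_proj q x" "\<lambda>q. gr_proj q y"]
    show "h' = ?h"
      using h[of "\<lambda>q. gr_proj q x" "\<lambda>q. gr_proj q y"] ext[OF x] ext[OF y] by simp
  qed
qed

section \<open>From Frechet derivatives to entrywise partial derivatives\<close>

lemma entry_partial_eq:
  assumes "g differentiable (at Q)"
  shows "entry_partial i j g Q = frechet_derivative g (at Q) (axis i (axis j 1))"
  unfolding entry_partial_def
  using DERIV_imp_deriv[OF directional_derivative_on_line[of g Q 0 "axis i (axis j 1)"]] assms by simp

lemma linear_matrix_unit_expansion:
  fixes L :: "real^'n^'m \<Rightarrow> real"
  assumes "linear L"
  shows "L A = (\<Sum>i\<in>UNIV. \<Sum>j\<in>UNIV. L (axis i (axis j 1)) * A $ i $ j)"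
proof -
  have "L A = L (\<Sum>i\<in>UNIV. \<Sum>j\<in>UNIV. A $ i $ j *\<^sub>R axis i (axis j 1))"
    by (simp flip: matrix_unit_expansion)
  then show ?thesis
    by (simp add: linear_sum[OF assms] linear_scale[OF assms] mult.commute)
qed

text \<open>\<open>trace (transpose A ** V)\<close> is the entrywise inner product of
  \<open>A\<close> and \<open>V\<close>, so expanding \<open>V\<close> in matrix units gives the
  directional derivative.\<close>

lemma trace_grad_matrix:
  assumes "f differentiable (at Q)"
  shows "trace (transpose (grad_matrix f Q) ** V) = frechet_derivative f (at Q) V"
proof -
  have "trace (transpose (grad_matrix f Q) ** V)
      = (\<Sum>j\<in>UNIV. \<Sum>i\<in>UNIV. entry_partial i j f Q * V $ i $ j)"
    by (simp add: trace_def matrix_matrix_mult_def transpose_def grad_matrix_def)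
  also have "\<dots> = (\<Sum>i\<in>UNIV. \<Sum>j\<in>UNIV. entry_partial i j f Q * V $ i $ j)"
    by (rule sum.swap)
  finally show ?thesis
    using linear_matrix_unit_expansion[OF linear_frechet_derivative[OF assms], of V]
    by (simp add: entry_partial_eq[OF assms])
qed

lemma second_form_eq:
  fixes f :: "real^'n^'n \<Rightarrow> real"
  assumes U: "open U" "Q \<in> U" "Ck_on 2 U f"
  shows "second_form f Q x y = frechet_derivative (\<lambda>q. frechet_derivative f (at q) y) (at Q) x"
proof -
  let ?G = "\<lambda>v q. frechet_derivative f (at q) v"
  let ?D = "\<lambda>v. frechet_derivative (?G v) (at Q)"
  have f: "f differentiable (at q)" if "q \<in> U" for q
    using U(3) that by (auto simp: numeral_2_eq_2)
  have G: "?G v differentiable (at Q)" for v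
    using U(2,3) by (auto simp: numeral_2_eq_2)
  have D_commute: "?D v u = ?D u v" for u v
    using second_derivative_symmetric[OF U] .
  have partial2: "entry_partial i j (entry_partial p l f) Q
      = ?D (axis p (axis l 1)) (axis i (axis j 1))" for i j p l
  proof -
    \<comment> \<open>The inner partial derivative is identified with a Frechet derivative
      throughout the open set \<open>U\<close>, so it may be differentiated once more at
      \<open>Q\<close>.\<close>
    have "(entry_partial p l f has_derivative ?D (axis p (axis l 1))) (at Q)"
      by (rule has_derivative_transform_within_open[OF _ U(1,2)])
        (use G f frechet_derivative_works in \<open>auto simp: entry_partial_eq\<close>)
    then show ?thesis
      using frechet_derivative_at by (metis entry_partial_eq differentiableI)
  qed
  have "?D y x = (\<Sum>i\<in>UNIV. \<Sum>j\<in>UNIV. ?D y (axis i (axis j 1)) * x $ i $ j)"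
    by (rule linear_matrix_unit_expansion[OF linear_frechet_derivative[OF G]])
  also have "\<dots> = (\<Sum>i\<in>UNIV. \<Sum>j\<in>UNIV.
      (\<Sum>p\<in>UNIV. \<Sum>l\<in>UNIV. ?D (axis p (axis l 1)) (axis i (axis j 1)) * y $ p $ l) * x $ i $ j)"
  proof -
    \<comment> \<open>Swapping the order of differentiation makes \<open>y\<close> the argument of
      an outer Frechet derivative, where linearity is immediate.\<close>
    have "?D y u = (\<Sum>p\<in>UNIV. \<Sum>l\<in>UNIV. ?D (axis p (axis l 1)) u * y $ p $ l)" for u
      unfolding D_commute[of _ u]
      by (rule linear_matrix_unit_expansion[OF linear_frechet_derivative[OF G]])
    then show ?thesis by presburger
  qed
  finally show ?thesis
    by (simp add: second_form_def partial2 sum_distrib_left sum_distrib_right mult_ac)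
qed

theorem proposition5p2:
  fixes f :: "real^'n^'n \<Rightarrow> real"
    and U :: "(real^'n^'n) set"
    and k :: nat
    and Q X Y :: "real^'n^'n"
  assumes "k \<in> {1..CARD('n)}"
    and "open U"
    and "Gr k \<subseteq> U"
    and "Ck_on 2 U f"
    and "Q \<in> Gr k"
    and "X \<in> tangent_space (Gr k) Q"
    and "Y \<in> tangent_space (Gr k) Q"
  shows "riemannian_hessian (Gr k) Gr_metric f Q X Y =
           second_form f Q X Y
           - 1/2 * trace (transpose (grad_matrix f Q) ** Q ** (X ** Y + Y ** X))"
proof -
  have "Q \<in> U" using assms(3,5) by blast
  then have "f differentiable (at Q)"
    using assms(4) by (auto simp: numeral_2_eq_2)
  then show ?thesis
    unfolding riemannian_hessian_Gr[OF assms(2-7)] second_form_eq[OF assms(2) \<open>Q \<in> U\<close> assms(4)]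
    by (simp add: trace_grad_matrix flip: matrix_mul_assoc)
qed

end
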